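(* Let $k,\ell\ge 3$ be integers such that either $k$ is odd and $\ell$ is even, or $k$ and $\ell$ have the same parity and $k\le\ell$, and let $d\in(0,1)$. There exist $d_1=d_1(k,\ell),d_2=d_2(k,\ell)\in[0,1]$ such that $p(n;C_k,C_\ell,d)=n^{-1}$ if $0<d\le d_1$, $p(n;C_k,C_\ell,d)=n^{-2}$ if $d_1<d\le d_2$, and $p(n;C_k,C_\ell,d)=0$ if $d_2<d$. Moreover: if $k$ and $\ell$ are both even then $d_1=d_2=0$; if $k$ is odd and $\ell$ is even then $d_1=d_2=1/2$; if $k$ is odd and $\ell=3$ then $d_1=1/2$ and $d_2=4/5$; if $k$ is odd and $\ell\ge5$ is odd then $d_1=1/2$ and $d_2=3/4$.
   Context: $C_m$ denotes the cycle of length $m$. A graph $G$ is $(H_1,H_2)$-Ramsey if every red/blue colouring of its edges contains a red copy of $H_1$ or a blue copy of $H_2$. The density of an $n$-vertex graph $G$ is $e(G)/\binom n2$. $G(n,p)$ is the binomial random graph on $[n]$ and $G_n\cup G(n,p)$ the union graph on $[n]$. For $0<d<1$, the perturbed Ramsey threshold $p(n;H_1,H_2,d)$ is a function such that: (i) if $p=\omega(p(n;H_1,H_2,d))$ then for every sequence $(G_n)$ of $n$-vertex graphs of density at least $d$, $G_n\cup G(n,p)$ is $(H_1,H_2)$-Ramsey with high probability; (ii) if $p=o(p(n;H_1,H_2,d))$ then for some such sequence $(G_n)$, with high probability $G_n\cup G(n,p)$ is not $(H_1,H_2)$-Ramsey. If every sufficiently large graph of density at least $d$ is already $(H_1,H_2)$-Ramsey,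 the threshold is defined to be $0$. *)

theory Defs
  imports Complex_Main
begin

definition all_pairs :: "nat \<Rightarrow> nat set set" where
  "all_pairs n = {e. \<exists>x y. x < n \<and> y < n \<and> x \<noteq> y \<and> e = {x, y}}"

definition graph_on :: "nat \<Rightarrow> nat set set \<Rightarrow> bool" where
  "graph_on n E \<longleftrightarrow> E \<subseteq> all_pairs n"

definition has_cycle :: "nat \<Rightarrow> nat set set \<Rightarrow> bool" where
  "has_cycle m E \<longleftrightarrow> (\<exists>f. inj_on f {..<m} \<and> (\<forall>i<m. {f i, f ((i + 1) mod m)} \<in> E))"

definition cycle_ramsey :: "nat \<Rightarrow> nat \<Rightarrow> nat set set \<Rightarrow> bool" where
  "cycle_ramsey k l E \<longleftrightarrow> (\<forall>R. R \<subseteq> E \<longrightarrow> has_cycle k R \<or> has_cycle l (E - R))"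

definition density :: "nat \<Rightarrow> nat set set \<Rightarrow> real" where
  "density n E = real (card E) / real (n choose 2)"

definition gnp_prob :: "nat \<Rightarrow> real \<Rightarrow> (nat set set \<Rightarrow> bool) \<Rightarrow> real" where
  "gnp_prob n p P = (\<Sum>S\<in>Pow (all_pairs n).
     if P S then p ^ card S * (1 - p) ^ (card (all_pairs n) - card S) else 0)"

definition dense_seq :: "real \<Rightarrow> (nat \<Rightarrow> nat set set) \<Rightarrow> bool" where
  "dense_seq d G \<longleftrightarrow> (\<forall>n. graph_on n (G n) \<and> (n \<ge> 2 \<longrightarrow> density n (G n) \<ge> d))"

definition prob_seq :: "(nat \<Rightarrow> real) \<Rightarrow> bool" where
  "prob_seq p \<longleftrightarrow> (\<forall>n. 0 \<le> p n \<and> p n \<le> 1)"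

definition perturbed_threshold ::
  "nat \<Rightarrow> nat \<Rightarrow> real \<Rightarrow> (nat \<Rightarrow> real) \<Rightarrow> bool" where
  "perturbed_threshold k l d q \<longleftrightarrow>
     (\<forall>p. prob_seq p \<and> filterlim (\<lambda>n. p n / q n) at_top sequentially \<longrightarrow>
        (\<forall>G. dense_seq d G \<longrightarrow>
           (\<lambda>n. gnp_prob n (p n) (\<lambda>S. cycle_ramsey k l (G n \<union> S))) \<longlonglongrightarrow> 1)) \<and>
     (\<forall>p. prob_seq p \<and> (\<lambda>n. p n / q n) \<longlonglongrightarrow> 0 \<longrightarrow>
        (\<exists>G. dense_seq d G \<and>
           (\<lambda>n. gnp_prob n (p n) (\<lambda>S. \<not> cycle_ramsey k l (G n \<union> S))) \<longlonglongrightarrow> 1))"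

definition threshold_zero :: "nat \<Rightarrow> nat \<Rightarrow> real \<Rightarrow> bool" where
  "threshold_zero k l d \<longleftrightarrow>
     (\<exists>N. \<forall>n\<ge>N. \<forall>E. graph_on n E \<and> density n E \<ge> d \<longrightarrow> cycle_ramsey k l E)"

end

theory Submission
  imports Defs "HOL-Library.Ramsey" "HOL-Library.FuncSet" "HOL-Analysis.Convex"
begin

text \<open>By Ramsey's theorem applied to copy indices, a two-coloured blow-up contains a blow-up in which
  the colour of an edge only depends on the two classes it joins, so it suffices to find monochromatic
  structures in small coloured complete graphs. A graph of density more than \<open>1 - 1 / s\<close> contains large
  blow-ups of \<open>K\<^bsub>s + 1\<^esub>\<close>: a monochromatic pair of classes yields all short even cycles, a
  monochromatic triangle all short odd cycles, and the triangle-free colouring of \<open>K\<^sub>5\<close> two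
  monochromatic pentagons, hence all short odd cycles but the triangle.

  For the perturbed thresholds the dense graph contributes positive density of copies of such a blow-up,
  and by the second moment method the random graph puts prescribed edges inside the parts of one of them.
  At \<open>p \<gg> n\<^sup>-\<^sup>2\<close> it adds matchings inside the parts of a blow-up of \<open>K\<^sub>3\<close>. Any two of the resulting six
  classes are joined, and a monochromatic triangle of classes uses at most one of the matchings,
  so that it still expands to odd cycles. At \<open>p \<gg> n\<^sup>-\<^sup>1\<close> it adds copies of \<open>C\<^sub>l\<close> and of \<open>C\<^sub>k\<close> inside the
  two parts of a blow-up of \<open>K\<^sub>2\<close>.

  Conversely, at \<open>p \<ll> n\<^sup>-\<^sup>1\<close> the random graph has no cycle of a given length, which together with a
  bipartite dense graph leaves a colouring by random and dense edges; at \<open>p \<ll> n\<^sup>-\<^sup>2\<close> the random graph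
  is empty, and the Turan graphs with four or five parts are decomposed into two bipartite graphs or into
  two blow-ups of the pentagon.\<close>

section \<open>Cycles in coloured blow-ups\<close>

lemma has_cycle_mono: "has_cycle m R \<Longrightarrow> R \<subseteq> S \<Longrightarrow> has_cycle m S"
  unfolding has_cycle_def by blast

text \<open>Alternation makes \<open>f i\<close> a function of the parity of \<open>i\<close>. The
  last index \<open>k - 1\<close> is even, like \<open>0\<close>, so the closing step back to
  \<open>0\<close> cannot alternate.\<close>

lemma no_alternating_odd_cycle:
  fixes f :: "nat \<Rightarrow> bool"
  assumes "odd k" and alt: "\<And>i. i < k \<Longrightarrow> f ((i + 1) mod k) \<longleftrightarrow> \<not> f i"
  shows False
proof -
  have "i < k \<Longrightarrow> f i \<longleftrightarrow> (f 0 \<longleftrightarrow> even i)" for i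
  proof (induction i)
    case (Suc i)
    then have "(i + 1) mod k = Suc i" by simp
    with alt[of i] Suc show ?case by simp
  qed simp
  from this[of "k - 1"] alt[of "k - 1"] \<open>odd k\<close> show False
    by (cases k) auto
qed

section \<open>Monochromatic triangles and pentagons in small complete graphs\<close>

text \<open>The pigeonhole proof that the Ramsey number R(3,3) is at most 6: vertex \<open>0\<close>
  sends three edges of one colour, and either two of their ends are joined in that colour or the
  three ends form a triangle in the other.\<close>

lemma triangle_in_two_coloured_K6:
  fixes \<rho> :: "nat \<Rightarrow> nat \<Rightarrow> bool"
  assumes "\<And>c d. \<rho> c d = \<rho> d c"
  obtains b c1 c2 c3 where "c1 < c2" "c2 < c3" "c3 < 6"
    "\<rho> c1 c2 = b" "\<rho> c2 c3 = b" "\<rho> c1 c3 = b"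
proof -
  have 1: "\<exists>b c1 c2 c3. c1 < c2 \<and> c2 < c3 \<and> c3 < 6 \<and> \<rho> c1 c2 = b \<and> \<rho> c2 c3 = b \<and> \<rho> c1 c3 = b"
    if *: "i < j" "j < k" "k < (6::nat)" "0 < i" "\<rho> 0 i = b" "\<rho> 0 j = b" "\<rho> 0 k = b" for i j k b
  proof -
    consider "\<rho> i j = b" | "\<rho> j k = b" | "\<rho> i k = b" | "\<rho> i j \<noteq> b" "\<rho> j k \<noteq> b" "\<rho> i k \<noteq> b" by blast
    then show ?thesis
    proof cases
      case 1
      with * show ?thesis by (intro exI[of _ b] exI[of _ 0] exI[of _ i] exI[of _ j]) auto
    next
      case 2
      with * show ?thesis by (intro exI[of _ b] exI[of _ 0] exI[of _ j] exI[of _ k]) auto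
    next
      case 3
      with * show ?thesis by (intro exI[of _ b] exI[of _ 0] exI[of _ i] exI[of _ k]) auto
    next
      case 4
      with * show ?thesis by (intro exI[of _ "\<not> b"] exI[of _ i] exI[of _ j] exI[of _ k]) auto
    qed
  qed
  define S where "S b = {i. 0 < i \<and> i < (6::nat) \<and> \<rho> 0 i = b}" for b
  have fin: "finite (S b)" for b by (rule finite_subset[of _ "{..<6}"]) (auto simp: S_def)
  have "S True \<union> S False = {1..5}" by (auto simp: S_def)
  then have "card {1..5::nat} \<le> card (S True) + card (S False)"
    using card_Un_le[of "S True" "S False"] by simp
  then have "card (S True) \<ge> 3 \<or> card (S False) \<ge> 3" by simp arith
  then obtain b where "card (S b) \<ge> 3" by blast
  then obtain T where T: "T \<subseteq> S b" "card T = 3" by (meson obtain_subset_with_card_n)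
  have finT: "finite T" using T fin finite_subset by blast
  let ?xs = "sorted_list_of_set T"
  have len: "length ?xs = 3" and xs: "set ?xs = T" "sorted_wrt (<) ?xs"
    using T finT by (auto)
  have three: "length ys = 3 \<Longrightarrow> \<exists>i j k. ys = [i, j, k]" for ys :: "nat list"
    by (auto simp: numeral_3_eq_3 length_Suc_conv)
  obtain i j k where "?xs = [i, j, k]"
    using three[OF len] by blast
  with xs T have "i < j" "j < k" "i \<in> S b" "j \<in> S b" "k \<in> S b" by auto
  then show thesis using 1[of i j k b] that unfolding S_def by blast
qed

text \<open>The variables are the colours of the pairs \<open>01, 02, 03, 04, 12, 13, 14, 23, 24, 34\<close>.\<close>

lemma triangle_or_pentagon_propositional:
  fixes a b c d e f g h i j :: bool
  assumes "a = (\<not> b) \<or> e = (\<not> b)" "a = (\<not> c) \<or> f = (\<not> c)" "a = (\<not> d) \<or> g = (\<not> d)" "b = (\<not> c) \<or> h = (\<not> c)"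
    "b = (\<not> d) \<or> i = (\<not> d)" "c = (\<not> d) \<or> j = (\<not> d)" "e = (\<not> f) \<or> h = (\<not> f)" "e = (\<not> g) \<or> i = (\<not> g)"
    "f = (\<not> g) \<or> j = (\<not> g)" "h = (\<not> i) \<or> j = (\<not> i)"
    "a \<or> e \<or> h \<or> j \<or> d" "a \<or> e \<or> i \<or> j \<or> c" "a \<or> f \<or> h \<or> i \<or> d" "a \<or> f \<or> j \<or> i \<or> b"
    "a \<or> g \<or> i \<or> h \<or> c" "a \<or> g \<or> j \<or> h \<or> b" "b \<or> e \<or> f \<or> j \<or> d" "b \<or> e \<or> g \<or> j \<or> c"
    "b \<or> h \<or> f \<or> g \<or> d" "b \<or> i \<or> g \<or> f \<or> c" "c \<or> f \<or> e \<or> i \<or> d" "c \<or> h \<or> e \<or> g \<or> d"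
  shows False
  using assms by (smt (verit))

text \<open>A triangle-free two-colouring of K_5 splits it into two pentagons. Only the pentagon of
  colour \<open>False\<close> is recorded: it will be expanded to a blue cycle of length
  \<open>l \<ge> 5\<close>, whereas the red length \<open>k\<close> may be 3.\<close>

lemma triangle_or_pentagon_in_two_coloured_K5:
  fixes \<rho> :: "nat \<Rightarrow> nat \<Rightarrow> bool"
  assumes sym: "\<And>c d. \<rho> c d = \<rho> d c"
  obtains (triangle) b c1 c2 c3 where "c1 < c2" "c2 < c3" "c3 < 5"
      "\<rho> c1 c2 = b" "\<rho> c2 c3 = b" "\<rho> c1 c3 = b"
  | (pentagon) c0 c1 c2 c3 c4 where "distinct [c0, c1, c2, c3, c4]" "{c0, c1, c2, c3, c4} \<subseteq> {..<5}"
      "\<not> \<rho> c0 c1" "\<not> \<rho> c1 c2" "\<not> \<rho> c2 c3" "\<not> \<rho> c3 c4" "\<not> \<rho> c4 c0"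
proof -
  have "(\<exists>b c1 c2 c3. c1 < c2 \<and> c2 < c3 \<and> c3 < 5 \<and> \<rho> c1 c2 = b \<and> \<rho> c2 c3 = b \<and> \<rho> c1 c3 = b)
    \<or> (\<exists>c0 c1 c2 c3 c4. distinct [c0, c1, c2, c3, c4] \<and> {c0, c1, c2, c3, c4} \<subseteq> {..<5} \<and>
      \<not> \<rho> c0 c1 \<and> \<not> \<rho> c1 c2 \<and> \<not> \<rho> c2 c3 \<and> \<not> \<rho> c3 c4 \<and> \<not> \<rho> c4 c0)" (is "?T \<or> ?P")
  proof (rule disjCI)
    assume noP: "\<not> ?P"
    have P: "\<rho> c0 c1 \<or> \<rho> c1 c2 \<or> \<rho> c2 c3 \<or> \<rho> c3 c4 \<or> \<rho> c4 c0"
      if "distinct [c0, c1, c2, c3, c4]" "{c0, c1, c2, c3, c4} \<subseteq> {..<5}" for c0 c1 c2 c3 c4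
      using noP that by blast
    show ?T
    proof (rule ccontr)
      assume noT: "\<not> ?T"
      have T: "\<rho> c1 c2 = (\<not> \<rho> c1 c3) \<or> \<rho> c2 c3 = (\<not> \<rho> c1 c3)" if "c1 < c2" "c2 < c3" "c3 < 5" for c1 c2 c3
        using noT that by blast
      \<comment> \<open>The ten triples of vertices, then the twelve Hamiltonian cycles of K_5.
        Afterwards every pair is written with its smaller vertex first, so that it matches a single
        propositional variable.\<close>
      note Ts = T[of 0 1 2] T[of 0 1 3] T[of 0 1 4] T[of 0 2 3] T[of 0 2 4] T[of 0 3 4]
        T[of 1 2 3] T[of 1 2 4] T[of 1 3 4] T[of 2 3 4]
      note Ps = P[of 0 1 2 3 4] P[of 0 1 2 4 3] P[of 0 1 3 2 4] P[of 0 1 3 4 2] P[of 0 1 4 2 3] P[of 0 1 4 3 2]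
        P[of 0 2 1 3 4] P[of 0 2 1 4 3] P[of 0 2 3 1 4] P[of 0 2 4 1 3] P[of 0 3 1 2 4] P[of 0 3 2 1 4]
      note sy = sym[of 4 0] sym[of 3 0] sym[of 2 0] sym[of "Suc 0" 0] sym[of 2 "Suc 0"] sym[of 3 "Suc 0"] sym[of 4 "Suc 0"]
        sym[of 3 2] sym[of 4 2] sym[of 4 3]
      show False
        by (rule triangle_or_pentagon_propositional[where a = "\<rho> 0 (Suc 0)" and b = "\<rho> 0 2" and c = "\<rho> 0 3" and d = "\<rho> 0 4" and
          e = "\<rho> (Suc 0) 2" and f = "\<rho> (Suc 0) 3" and g = "\<rho> (Suc 0) 4" and
          h = "\<rho> 2 3" and i = "\<rho> 2 4" and j = "\<rho> 3 4"]) (fact Ts[simplified] Ps[simplified, unfolded sy])+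
    qed
  qed
  then show thesis
  proof (elim disjE exE conjE)
    fix b c1 c2 c3
    assume "c1 < c2" "c2 < c3" "c3 < 5" "\<rho> c1 c2 = b" "\<rho> c2 c3 = b" "\<rho> c1 c3 = b"
    then show thesis by (rule triangle)
  next
    fix c0 c1 c2 c3 c4
    assume "distinct [c0, c1, c2, c3, c4]" "{c0, c1, c2, c3, c4} \<subseteq> {..<5}"
      "\<not> \<rho> c0 c1" "\<not> \<rho> c1 c2" "\<not> \<rho> c2 c3" "\<not> \<rho> c3 c4" "\<not> \<rho> c4 c0"
    then show thesis by (rule pentagon)
  qed
qed

text \<open>A vertex \<open>\<phi> (c, j)\<close> is the \<open>j\<close>-th copy of the class \<open>c\<close>. Classes in different parts are completely
  joined, whereas a link \<open>(c, d) \<in> L\<close> only joins equal copies; the links will be provided by the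
  random graph.\<close>

definition blowup :: "nat \<Rightarrow> (nat \<Rightarrow> nat) \<Rightarrow> (nat \<times> nat) set \<Rightarrow> nat \<Rightarrow> (nat \<times> nat \<Rightarrow> nat) \<Rightarrow> nat set set \<Rightarrow> bool"
  where "blowup q part L m \<phi> E \<longleftrightarrow> inj_on \<phi> ({..<q} \<times> {..<m}) \<and>
    (\<forall>c<q. \<forall>d<q. part c \<noteq> part d \<longrightarrow> (\<forall>i<m. \<forall>j<m. {\<phi> (c, i), \<phi> (d, j)} \<in> E)) \<and>
    (\<forall>c<q. \<forall>d<q. (c, d) \<in> L \<longrightarrow> (\<forall>j<m. {\<phi> (c, j), \<phi> (d, j)} \<in> E))"

section \<open>Cycles in homogeneously coloured blow-ups\<close>

text \<open>\<open>\<rho> c d\<close> stands for red. Classes of different parts have one colour for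
  all their copies; classes of one part are compared at equal copies only, which is all that a link
  offers. Whether such a pair is an edge at all is left to \<open>joined\<close>.\<close>

locale coloured_blowup =
  fixes q :: nat and part :: "nat \<Rightarrow> nat" and L :: "(nat \<times> nat) set" and m :: nat
    and \<phi> :: "nat \<times> nat \<Rightarrow> nat" and E R :: "nat set set" and \<rho> :: "nat \<Rightarrow> nat \<Rightarrow> bool"
  assumes blowup: "blowup q part L m \<phi> E"
    and colour_cross: "\<And>c d i j. c < q \<Longrightarrow> d < q \<Longrightarrow> part c \<noteq> part d \<Longrightarrow> i < m \<Longrightarrow> j < m \<Longrightarrow>
      {\<phi> (c, i), \<phi> (d, j)} \<in> R \<longleftrightarrow> \<rho> c d"
    and colour_copy: "\<And>c d j. c < q \<Longrightarrow> d < q \<Longrightarrow> part c = part d \<Longrightarrow> j < m \<Longrightarrow>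
      {\<phi> (c, j), \<phi> (d, j)} \<in> R \<longleftrightarrow> \<rho> c d"
    and colour_sym: "\<And>c d. \<rho> c d \<longleftrightarrow> \<rho> d c"
begin

definition colour_class :: "bool \<Rightarrow> nat set set" where
  "colour_class b = (if b then R else E - R)"

definition joined :: "nat \<Rightarrow> nat \<Rightarrow> bool" where
  "joined c d \<longleftrightarrow> part c \<noteq> part d \<or> (c, d) \<in> L \<or> (d, c) \<in> L"

lemma phi_eq_iff:
  "c < q \<Longrightarrow> d < q \<Longrightarrow> i < m \<Longrightarrow> j < m \<Longrightarrow> \<phi> (c, i) = \<phi> (d, j) \<longleftrightarrow> c = d \<and> i = j"
  using blowup unfolding blowup_def by (auto simp: inj_on_def)

lemma cross_edge:
  "c < q \<Longrightarrow> d < q \<Longrightarrow> part c \<noteq> part d \<Longrightarrow> i < m \<Longrightarrow> j < m \<Longrightarrow> \<rho> c d = b \<Longrightarrow>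
    {\<phi> (c, i), \<phi> (d, j)} \<in> colour_class b"
  using colour_cross[of c d i j] blowup unfolding blowup_def colour_class_def by auto

lemma copy_edge:
  assumes "c < q" "d < q" "joined c d" "j < m" "\<rho> c d = b"
  shows "{\<phi> (c, j), \<phi> (d, j)} \<in> colour_class b"
proof (cases "part c = part d")
  case True
  then have "{\<phi> (c, j), \<phi> (d, j)} \<in> E"
    using assms blowup unfolding joined_def blowup_def by (auto simp: insert_commute)
  then show ?thesis
    using colour_copy[of c d j] True assms unfolding colour_class_def by auto
next
  case False
  with assms cross_edge show ?thesis by blast
qed

text \<open>Fresh copy indices turn a closed walk on classes into a cycle, however often the walk
  revisits a class. Only the first step may be a link, so positions \<open>0\<close> and
  \<open>1\<close> share copy \<open>0\<close> and are told apart by their classes; all other steps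
  are cross edges.\<close>

lemma cycle_of_closed_walk:
  assumes "3 \<le> n" "n \<le> m" and w: "\<And>i. i < n \<Longrightarrow> w i < q"
    and first: "w 0 \<noteq> w 1" "joined (w 0) (w 1)" "\<rho> (w 0) (w 1) = b"
    and steps: "\<And>i. 1 \<le> i \<Longrightarrow> i < n - 1 \<Longrightarrow> part (w i) \<noteq> part (w (i + 1)) \<and> \<rho> (w i) (w (i + 1)) = b"
    and last: "part (w (n - 1)) \<noteq> part (w 0)" "\<rho> (w (n - 1)) (w 0) = b"
  shows "has_cycle n (colour_class b)"
  unfolding has_cycle_def
proof (intro exI conjI allI impI)
  define t where "t i = (if i \<le> 1 then 0 else i)" for i :: nat
  let ?f = "\<lambda>i. \<phi> (w i, t i)"
  have tm: "t i < m" if "i < n" for i using that assms by (auto simp: t_def)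
  show "inj_on ?f {..<n}"
  proof (rule inj_onI)
    fix i j assume "i \<in> {..<n}" "j \<in> {..<n}" "?f i = ?f j"
    then have eq: "w i = w j" "t i = t j" using phi_eq_iff w tm by auto
    show "i = j"
    proof (cases "i \<le> 1 \<and> j \<le> 1")
      case True
      then have "(i = 0 \<or> i = 1) \<and> (j = 0 \<or> j = 1)" by auto
      then show ?thesis using eq first by auto
    qed (use eq in \<open>auto simp: t_def split: if_splits\<close>)
  qed
  fix i assume i: "i < n"
  consider "i = 0" | "1 \<le> i" "i < n - 1" | "i = n - 1" using i by linarith
  then show "{?f i, ?f ((i + 1) mod n)} \<in> colour_class b"
  proof cases
    case 1
    have "{\<phi> (w 0, 0), \<phi> (w 1, 0)} \<in> colour_class b"
      using copy_edge first w assms by simp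
    with 1 show ?thesis using assms(1) by (simp add: t_def)
  next
    case 2
    then have "(i + 1) mod n = i + 1" by simp
    with 2 show ?thesis
      using steps[of i] w tm assms(1) by (simp only:) (rule cross_edge; simp)
  next
    case 3
    have "(i + 1) mod n = 0" using 3 assms(1) by simp
    then show ?thesis
      using 3 w tm last i by (simp only:) (rule cross_edge; simp)
  qed
qed

lemma even_cycle:
  assumes "c < q" "d < q" "part c \<noteq> part d" "\<rho> c d = b" "even n" "4 \<le> n" "n \<le> m"
  shows "has_cycle n (colour_class b)"
proof (rule cycle_of_closed_walk)
  let ?w = "\<lambda>i::nat. if even i then c else d"
  show "?w i < q" for i using assms by simp
  show "part (?w i) \<noteq> part (?w (i + 1)) \<and> \<rho> (?w i) (?w (i + 1)) = b" for i
    using assms colour_sym by auto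
qed (use assms colour_sym in \<open>auto simp: joined_def\<close>)

text \<open>The walk goes once from \<open>c0\<close> to \<open>c1\<close>, possibly along a link,
  and then alternates between \<open>c1\<close> and \<open>c2\<close>. As \<open>n\<close> is odd it
  ends in \<open>c2\<close>, next to \<open>c0\<close>.\<close>

lemma odd_cycle_of_triangle:
  assumes "c0 < q" "c1 < q" "c2 < q" "c0 \<noteq> c1" "joined c0 c1" "part c1 \<noteq> part c2" "part c2 \<noteq> part c0"
    and "\<rho> c0 c1 = b" "\<rho> c1 c2 = b" "\<rho> c2 c0 = b" "odd n" "3 \<le> n" "n \<le> m"
  shows "has_cycle n (colour_class b)"
proof (rule cycle_of_closed_walk)
  let ?w = "\<lambda>i::nat. if i = 0 then c0 else if even i then c2 else c1"
  show "?w i < q" for i using assms by simp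
  show "part (?w i) \<noteq> part (?w (i + 1)) \<and> \<rho> (?w i) (?w (i + 1)) = b" if "1 \<le> i" for i
    using assms colour_sym that by auto
qed (use assms colour_sym in auto)

text \<open>As for triangles, with the surplus length spent on going back and forth between
  \<open>c3\<close> and \<open>c4\<close>.\<close>

lemma odd_cycle_of_pentagon:
  assumes "c0 < q" "c1 < q" "c2 < q" "c3 < q" "c4 < q" "c0 \<noteq> c1" "joined c0 c1"
    and "part c1 \<noteq> part c2" "part c2 \<noteq> part c3" "part c3 \<noteq> part c4" "part c4 \<noteq> part c0"
    and "\<rho> c0 c1 = b" "\<rho> c1 c2 = b" "\<rho> c2 c3 = b" "\<rho> c3 c4 = b" "\<rho> c4 c0 = b" "odd n" "5 \<le> n" "n \<le> m"
  shows "has_cycle n (colour_class b)"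
proof (rule cycle_of_closed_walk)
  let ?w = "\<lambda>i::nat. if i = 0 then c0 else if i = 1 then c1 else if i = 2 then c2 else if even i then c4 else c3"
  show "?w i < q" for i using assms by simp
  show "part (?w i) \<noteq> part (?w (i + 1)) \<and> \<rho> (?w i) (?w (i + 1)) = b" if i: "1 \<le> i" for i
  proof -
    consider "i = 1" | "i = 2" | "i = 3" | "i \<ge> 4" using i by linarith
    then show ?thesis using assms colour_sym by cases auto
  qed
qed (use assms colour_sym in auto)

text \<open>All vertices are taken at copy \<open>0\<close>, so every step may be a link; in
  exchange the classes have to be distinct.\<close>

lemma cycle_of_links:
  assumes "3 \<le> n" "0 < m" and w: "\<And>i. i < n \<Longrightarrow> w i < q" "inj_on w {..<n}"
    and edges: "\<And>i. i < n \<Longrightarrow> joined (w i) (w ((i + 1) mod n)) \<and> \<rho> (w i) (w ((i + 1) mod n)) = b"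
  shows "has_cycle n (colour_class b)"
  unfolding has_cycle_def
proof (intro exI conjI allI impI)
  let ?f = "\<lambda>i. \<phi> (w i, 0)"
  show "inj_on ?f {..<n}"
    using w assms(2) phi_eq_iff by (auto simp: inj_on_def)
  show "{?f i, ?f ((i + 1) mod n)} \<in> colour_class b" if "i < n" for i
    using that w edges assms by (intro copy_edge) auto
qed

end

section \<open>Patterns that force one of the two cycles\<close>

text \<open>The size \<open>m\<close> depends on the pattern and on the two lengths, not on the
  graph or its colouring. Homogeneous colourings suffice because Ramsey's theorem reduces every
  colouring to one of them.\<close>

definition forces :: "nat \<Rightarrow> (nat \<Rightarrow> nat) \<Rightarrow> (nat \<times> nat) set \<Rightarrow> nat \<Rightarrow> nat \<Rightarrow> bool" where
  "forces q part L k l \<longleftrightarrow> (\<exists>m. \<forall>\<phi> E R \<rho>. R \<subseteq> E \<longrightarrow> coloured_blowup q part L m \<phi> E R \<rho> \<longrightarrow>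
     has_cycle k R \<or> has_cycle l (E - R))"

lemma forcesI:
  assumes "\<And>m \<phi> E R \<rho>. coloured_blowup q part L m \<phi> E R \<rho> \<Longrightarrow> k \<le> m \<Longrightarrow> l \<le> m \<Longrightarrow>
    has_cycle k (coloured_blowup.colour_class E R True) \<or> has_cycle l (coloured_blowup.colour_class E R False)"
  shows "forces q part L k l"
  unfolding forces_def
proof (intro exI[of _ "max k l"] allI impI)
  fix \<phi> E R \<rho> assume *: "coloured_blowup q part L (max k l) \<phi> E R \<rho>"
  from assms[OF *] show "has_cycle k R \<or> has_cycle l (E - R)"
    by (simp add: coloured_blowup.colour_class_def[OF *])
qed

lemma forces_even_even:
  assumes "even k" "even l" "3 \<le> k" "3 \<le> l"
  shows "forces 2 id {} k l"
proof (rule forcesI)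
  fix m \<phi> E R \<rho> assume "coloured_blowup 2 id {} m \<phi> E R \<rho>" and m: "k \<le> m" "l \<le> m"
  then interpret coloured_blowup 2 id "{}" m \<phi> E R \<rho> by simp
  have "4 \<le> k" "4 \<le> l" using assms by presburger+
  then show "has_cycle k (colour_class True) \<or> has_cycle l (colour_class False)"
    using even_cycle[of 0 1 True k] even_cycle[of 0 1 False l] m assms by auto
qed

text \<open>Either the triangle of classes is red and expands to a red odd cycle, or one of its
  pairs is blue and alone yields the blue even cycle.\<close>

lemma forces_odd_even:
  assumes "odd k" "even l" "3 \<le> k" "3 \<le> l"
  shows "forces 3 id {} k l"
proof (rule forcesI)
  fix m \<phi> E R \<rho> assume "coloured_blowup 3 id {} m \<phi> E R \<rho>" and m: "k \<le> m" "l \<le> m"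
  then interpret coloured_blowup 3 id "{}" m \<phi> E R \<rho> by simp
  have l: "4 \<le> l" using assms by presburger+
  show "has_cycle k (colour_class True) \<or> has_cycle l (colour_class False)"
  proof (cases "\<rho> 0 1 \<and> \<rho> 1 2 \<and> \<rho> 2 0")
    case True
    then have "has_cycle k (colour_class True)"
      using m assms by (intro odd_cycle_of_triangle[of 0 1 2]) (auto simp: joined_def)
    then show ?thesis ..
  next
    case False
    then obtain c d :: nat where "c < 3" "d < 3" "c \<noteq> d" "\<not> \<rho> c d"
      by (cases "\<rho> 0 1"; cases "\<rho> 1 2") fastforce+
    then have "has_cycle l (colour_class False)"
      using m assms l by (intro even_cycle[of c d]) auto
    then show ?thesis ..
  qed
qed

text \<open>A triangle of either colour expands to every odd length from 3 on, a blue pentagon to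
  every odd length from 5 on, which reaches \<open>l\<close>.\<close>

lemma forces_K5:
  assumes "odd k" "odd l" "3 \<le> k" "5 \<le> l"
  shows "forces 5 id {} k l"
proof (rule forcesI)
  fix m \<phi> E R \<rho> assume "coloured_blowup 5 id {} m \<phi> E R \<rho>" and m: "k \<le> m" "l \<le> m"
  then interpret coloured_blowup 5 id "{}" m \<phi> E R \<rho> by simp
  show "has_cycle k (colour_class True) \<or> has_cycle l (colour_class False)"
  proof (rule triangle_or_pentagon_in_two_coloured_K5[of \<rho>, OF colour_sym])
    fix b c1 c2 c3
    assume "c1 < c2" "c2 < c3" "c3 < 5" "\<rho> c1 c2 = b" "\<rho> c2 c3 = b" "\<rho> c1 c3 = b"
    then have "has_cycle n (colour_class b)" if "odd n" "3 \<le> n" "n \<le> m" for n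
      using that colour_sym by (intro odd_cycle_of_triangle[of c1 c2 c3]) (auto simp: joined_def)
    then show ?thesis using m assms by (cases b) auto
  next
    fix c0 c1 c2 c3 c4
    assume "distinct [c0, c1, c2, c3, c4]" "{c0, c1, c2, c3, c4} \<subseteq> {..<5}"
      "\<not> \<rho> c0 c1" "\<not> \<rho> c1 c2" "\<not> \<rho> c2 c3" "\<not> \<rho> c3 c4" "\<not> \<rho> c4 c0"
    then have "has_cycle l (colour_class False)"
      using m assms by (intro odd_cycle_of_pentagon[of c0 c1 c2 c3 c4]) (auto simp: joined_def)
    then show ?thesis ..
  qed
qed

text \<open>The hypothesis makes all six classes pairwise joined, with at most two in each part. A
  monochromatic triangle then uses at most one link, and it is rotated so that this link comes
  first. The two intended cases are six separate parts, and three parts of two linked classes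
  each.\<close>

lemma forces_K6:
  assumes "odd k" "odd l" "3 \<le> k" "3 \<le> l"
    and joined: "\<And>c d. c < d \<Longrightarrow> d < 6 \<Longrightarrow> part c \<noteq> part d \<or> even c \<and> d = c + 1 \<and> (c, d) \<in> L"
  shows "forces 6 part L k l"
proof (rule forcesI)
  fix m \<phi> E R \<rho> assume "coloured_blowup 6 part L m \<phi> E R \<rho>" and m: "k \<le> m" "l \<le> m"
  then interpret coloured_blowup 6 part L m \<phi> E R \<rho> by simp
  obtain b c1 c2 c3 where c: "c1 < c2" "c2 < c3" "c3 < 6" and \<rho>: "\<rho> c1 c2 = b" "\<rho> c2 c3 = b" "\<rho> c1 c3 = b"
    using triangle_in_two_coloured_K6[of \<rho>] colour_sym by metis
  \<comment> \<open>Classes of one part are consecutive, so \<open>c1\<close> and \<open>c3\<close>,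
    with \<open>c2\<close> between them, lie in different parts.\<close>
  have j: "joined c1 c2" "joined c2 c3" "part c1 \<noteq> part c3" "part c1 \<noteq> part c2 \<or> part c2 \<noteq> part c3"
    using joined[of c1 c2] joined[of c2 c3] joined[of c1 c3] c unfolding joined_def by auto
  have "has_cycle n (colour_class b)" if n: "odd n" "3 \<le> n" "n \<le> m" for n
  proof (cases "part c2 = part c3")
    case True
    then show ?thesis using c j \<rho> n colour_sym by (intro odd_cycle_of_triangle[of c2 c3 c1]) auto
  next
    case False
    then show ?thesis using c j \<rho> n colour_sym by (intro odd_cycle_of_triangle[of c1 c2 c3]) auto
  qed
  then show "has_cycle k (colour_class True) \<or> has_cycle l (colour_class False)"
    using m assms by (cases b) auto
qed

text \<open>The links are oriented around the cycles, so that each class is the source of one link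
  only. This is what bounds the number of links by the number of vertices they cover.\<close>

definition two_cycles :: "nat \<Rightarrow> nat \<Rightarrow> (nat \<times> nat) set" where
  "two_cycles l k = {(c, (c + 1) mod l) | c. c < l} \<union> {(l + c, l + (c + 1) mod k) | c. c < k}"

definition two_parts :: "nat \<Rightarrow> nat \<Rightarrow> nat" where
  "two_parts l c = (if c < l then 0 else 1)"

text \<open>A blue cross pair already yields the blue even cycle. Otherwise all cross pairs are red,
  and so is some link of the \<open>l\<close>-cycle; with any class of the other part it forms a red
  triangle, which expands to length \<open>k\<close>.\<close>

lemma forces_odd_even_links:
  assumes "odd k" "even l" "3 \<le> k" "3 \<le> l"
  shows "forces (l + k) (two_parts l) (two_cycles l k) k l"
proof (rule forcesI)
  fix m \<phi> E R \<rho> assume "coloured_blowup (l + k) (two_parts l) (two_cycles l k) m \<phi> E R \<rho>"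
    and m: "k \<le> m" "l \<le> m"
  then interpret coloured_blowup "l + k" "two_parts l" "two_cycles l k" m \<phi> E R \<rho> by simp
  have l: "4 \<le> l" using assms by presburger+
  have link: "joined c ((c + 1) mod l)" if "c < l" for c
  proof -
    have "(c, (c + 1) mod l) \<in> two_cycles l k" using that by (auto simp: two_cycles_def)
    then show ?thesis by (simp add: joined_def)
  qed
  show "has_cycle k (colour_class True) \<or> has_cycle l (colour_class False)"
  proof (rule disjCI)
    assume no_blue: "\<not> has_cycle l (colour_class False)"
    have red: "\<rho> c (l + d)" if "c < l" "d < k" for c d
      using even_cycle[of c "l + d" False l] that m assms l no_blue by (auto simp: two_parts_def)
    have "\<exists>c<l. \<rho> c ((c + 1) mod l)"
    proof (rule ccontr)
      assume "\<not> ?thesis"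
      then have "has_cycle l (colour_class False)"
        using link assms m by (intro cycle_of_links[of l id]) auto
      with no_blue show False ..
    qed
    then obtain c where c: "c < l" "\<rho> c ((c + 1) mod l)" by blast
    then have "c \<noteq> (c + 1) mod l" "(c + 1) mod l < l + k" using l by (auto simp: mod_Suc)
    with c show "has_cycle k (colour_class True)"
      using link red[of c 0] red[of "(c + 1) mod l" 0] assms m
      by (intro odd_cycle_of_triangle[of c "(c + 1) mod l" l]) (auto simp: two_parts_def colour_sym)
  qed
qed

text \<open>If some link \<open>a\<close>, \<open>a'\<close> of the \<open>l\<close>-cycle is red, then no class of the \<open>k\<close>-cycle is joined in red to
  both ends, and by parity some class \<open>b0\<close> is joined in blue to both. A blue link \<open>b\<close>, \<open>b'\<close> of the \<open>k\<close>-cycle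
  then yields a blue pentagon \<open>b b' a' b0 a\<close> (or a blue triangle), which expands to a blue \<open>l\<close>-cycle.\<close>

lemma forces_odd_odd_links:
  assumes "odd k" "odd l" "3 \<le> k" "5 \<le> l"
  shows "forces (l + k) (two_parts l) (two_cycles l k) k l"
proof (rule forcesI)
  fix m \<phi> E R \<rho> assume "coloured_blowup (l + k) (two_parts l) (two_cycles l k) m \<phi> E R \<rho>"
    and m: "k \<le> m" "l \<le> m"
  then interpret coloured_blowup "l + k" "two_parts l" "two_cycles l k" m \<phi> E R \<rho> by simp
  have link: "joined c ((c + 1) mod l)" if "c < l" for c
  proof -
    have "(c, (c + 1) mod l) \<in> two_cycles l k" using that by (auto simp: two_cycles_def)
    then show ?thesis by (simp add: joined_def)
  qed
  have link': "joined (l + c) (l + (c + 1) mod k)" if "c < k" for c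
  proof -
    have "(l + c, l + (c + 1) mod k) \<in> two_cycles l k" using that by (auto simp: two_cycles_def)
    then show ?thesis by (simp add: joined_def)
  qed
  show "has_cycle k (colour_class True) \<or> has_cycle l (colour_class False)"
  proof (rule disjCI, rule ccontr)
    assume no_blue: "\<not> has_cycle l (colour_class False)" and no_red: "\<not> has_cycle k (colour_class True)"
    have "\<exists>c<l. \<rho> c ((c + 1) mod l)"
    proof (rule ccontr)
      assume "\<not> ?thesis"
      then have "has_cycle l (colour_class False)"
        using link assms m by (intro cycle_of_links[of l id]) auto
      with no_blue show False ..
    qed
    then obtain a where a: "a < l" "\<rho> a ((a + 1) mod l)" by blast
    define a' where "a' = (a + 1) mod l"
    have a: "a < l" "a' < l" "a \<noteq> a'" "joined a a'" "\<rho> a a'"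
      using a link[of a] assms by (auto simp: a'_def mod_Suc)
    have not_both_red: "\<not> (\<rho> a (l + c) \<and> \<rho> a' (l + c))" if "c < k" for c
    proof
      assume "\<rho> a (l + c) \<and> \<rho> a' (l + c)"
      then have "has_cycle k (colour_class True)" using a that m assms
        by (intro odd_cycle_of_triangle[of a a' "l + c"]) (auto simp: two_parts_def colour_sym)
      with no_red show False ..
    qed
    \<comment> \<open>A link of the \<open>k\<close>-cycle and its two joins to \<open>x\<close>
      never have the same colour, since a monochromatic triangle expands to both odd
      lengths.\<close>
    have differ: "\<not> (\<rho> (l + c) (l + (c + 1) mod k) = b \<and> \<rho> x (l + c) = b \<and> \<rho> x (l + (c + 1) mod k) = b)"
      if "c < k" "x < l" for c x b
    proof
      assume *: "\<rho> (l + c) (l + (c + 1) mod k) = b \<and> \<rho> x (l + c) = b \<and> \<rho> x (l + (c + 1) mod k) = b"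
      have "c \<noteq> (c + 1) mod k" using that assms by (auto simp: mod_Suc)
      with * have "has_cycle n (colour_class b)" if "odd n" "3 \<le> n" "n \<le> m" for n
        using that link'[OF \<open>c < k\<close>] \<open>c < k\<close> \<open>x < l\<close> colour_sym
        by (intro odd_cycle_of_triangle[of "l + c" "l + (c + 1) mod k" x]) (auto simp: two_parts_def)
      then show False using no_red no_blue assms m by (cases b) auto
    qed
    have "\<exists>c<k. \<not> \<rho> a (l + c) \<and> \<not> \<rho> a' (l + c)"
    proof (rule ccontr)
      assume "\<not> ?thesis"
      then have one: "\<rho> a (l + c) \<longleftrightarrow> \<not> \<rho> a' (l + c)" if "c < k" for c
        using not_both_red that by blast
      show False
      \<comment> \<open>Each class now has one red and one blue join to \<open>a\<close> and
        \<open>a'\<close>. If two consecutive classes agreed, the link between them would close a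
        monochromatic triangle with \<open>a\<close> or with \<open>a'\<close>, whatever its
        colour.\<close>
      proof (rule no_alternating_odd_cycle[OF \<open>odd k\<close>, of "\<lambda>c. \<rho> a (l + c)"])
        fix c assume c: "c < k"
        then have "(c + 1) mod k < k" by simp
        with c show "\<rho> a (l + (c + 1) mod k) \<longleftrightarrow> \<not> \<rho> a (l + c)"
          using one differ[of c a] differ[of c a'] a by metis
      qed
    qed
    then obtain b0 where b0: "b0 < k" "\<not> \<rho> a (l + b0)" "\<not> \<rho> a' (l + b0)" by blast
    have "\<exists>c<k. \<not> \<rho> (l + c) (l + (c + 1) mod k)"
    proof (rule ccontr)
      assume "\<not> ?thesis"
      then have "has_cycle k (colour_class True)"
        using link' assms m by (intro cycle_of_links[of k "\<lambda>c. l + c"]) auto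
      with no_red show False ..
    qed
    then obtain b where b: "b < k" "\<not> \<rho> (l + b) (l + (b + 1) mod k)" by blast
    define b' where "b' = (b + 1) mod k"
    have b': "b' < k" "b \<noteq> b'" "joined (l + b) (l + b')"
      using b link' assms by (auto simp: b'_def mod_Suc)
    have blue: "\<not> \<rho> (l + b) (l + b')" using b by (simp add: b'_def)
    have one: "(\<not> \<rho> x (l + b) \<and> \<rho> x (l + b')) \<or> (\<rho> x (l + b) \<and> \<not> \<rho> x (l + b')) \<or> (\<rho> x (l + b) \<and> \<rho> x (l + b'))"
      if "x < l" for x
      using differ[OF b(1) that, of False] blue by (auto simp: b'_def)
    \<comment> \<open>Each of \<open>a\<close>, \<open>a'\<close> has a red join to \<open>b\<close>
      or \<open>b'\<close>, and neither \<open>b\<close> nor \<open>b'\<close> is red to both. So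
      the red joins form a perfect matching, and so do the blue ones.\<close>
    consider "\<not> \<rho> a (l + b)" "\<not> \<rho> a' (l + b')" | "\<not> \<rho> a' (l + b)" "\<not> \<rho> a (l + b')"
      using one[of a] one[of a'] not_both_red[of b] not_both_red[of b'] a b b' by auto
    then have "has_cycle l (colour_class False)"
    proof cases
      case 1
      then show ?thesis using a b0 b b' m blue assms colour_sym
        by (intro odd_cycle_of_pentagon[of "l + b" "l + b'" a' "l + b0" a]) (auto simp: two_parts_def)
    next
      case 2
      then show ?thesis using a b0 b b' m blue assms colour_sym
        by (intro odd_cycle_of_pentagon[of "l + b" "l + b'" a "l + b0" a']) (auto simp: two_parts_def)
    qed
    with no_blue show False ..
  qed
qed

text \<open>A 3-cycle of links is complete, so all six classes are pairwise joined and a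
  monochromatic triangle of classes exists. As only length 3 is wanted, a triangle consisting of
  links is good enough.\<close>

lemma forces_3_3_links: "forces (3 + 3) (two_parts 3) (two_cycles 3 3) 3 3"
proof (rule forcesI)
  fix m \<phi> E R \<rho> assume "coloured_blowup (3 + 3) (two_parts 3) (two_cycles 3 3) m \<phi> E R \<rho>"
    and m: "3 \<le> m"
  then interpret coloured_blowup "3 + 3" "two_parts 3" "two_cycles 3 3" m \<phi> E R \<rho> by simp
  obtain b c1 c2 c3 where c: "c1 < c2" "c2 < c3" "c3 < 6" and \<rho>: "\<rho> c1 c2 = b" "\<rho> c2 c3 = b" "\<rho> c1 c3 = b"
    using triangle_in_two_coloured_K6[of \<rho>] colour_sym by metis
  have L: "(0, 1) \<in> two_cycles 3 3" "(1, 2) \<in> two_cycles 3 3" "(2, 0) \<in> two_cycles 3 3"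
    "(3, 4) \<in> two_cycles 3 3" "(4, 5) \<in> two_cycles 3 3" "(5, 3) \<in> two_cycles 3 3"
    unfolding two_cycles_def by force+
  have joined: "joined c d" if "c < d" "d < 6" for c d
  proof -
    have "c \<in> {0, 1, 2, 3, 4, 5}" "d \<in> {0, 1, 2, 3, 4, 5}" using that by auto
    then show ?thesis using L that by (auto simp: joined_def two_parts_def)
  qed
  have j: "joined c1 c2" "joined c2 c3" "joined c1 c3" using joined c by auto
  have "has_cycle 3 (colour_class b)"
  proof (cases "two_parts 3 c1 = two_parts 3 c3")
    case True
    let ?w = "\<lambda>i::nat. if i = 0 then c1 else if i = 1 then c2 else c3"
    show ?thesis
    proof (rule cycle_of_links[of 3 ?w])
      show "inj_on ?w {..<3}" using c by (auto simp: inj_on_def)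
      show "joined (?w i) (?w ((i + 1) mod 3)) \<and> \<rho> (?w i) (?w ((i + 1) mod 3)) = b" if "i < 3" for i
      proof -
        have "i = 0 \<or> i = 1 \<or> i = 2" using that by auto
        then show ?thesis using j \<rho> colour_sym by (auto simp: joined_def)
      qed
    qed (use c m in auto)
  next
    case False
    show ?thesis
    proof (cases "two_parts 3 c1 = two_parts 3 c2")
      case True
      with False show ?thesis using c j \<rho> colour_sym m
        by (intro odd_cycle_of_triangle[of c1 c2 c3]) auto
    next
      case F: False
      with False have "two_parts 3 c2 = two_parts 3 c3" by (auto simp: two_parts_def split: if_splits)
      with F False show ?thesis using c j \<rho> colour_sym m
        by (intro odd_cycle_of_triangle[of c2 c3 c1]) auto
    qed
  qed
  then show "has_cycle 3 (colour_class True) \<or> has_cycle 3 (colour_class False)" by (cases b) auto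
qed

section \<open>Homogeneous blow-ups\<close>

text \<open>Ramsey's theorem repackaged for an arbitrary finite set of colours and an increasing
  enumeration \<open>g\<close> of the homogeneous set. \<open>f\<close> need not be symmetric,
  because a pair is coloured through its minimum and maximum.\<close>

lemma ramsey_pairs:
  fixes P :: "'b set" and m :: nat
  assumes "finite P"
  shows "\<exists>N. \<forall>f :: nat \<Rightarrow> nat \<Rightarrow> 'b. (\<forall>i j. f i j \<in> P) \<longrightarrow>
    (\<exists>g b. (\<forall>i<m. g i < N) \<and> (\<forall>i j. i < j \<and> j < m \<longrightarrow> g i < g j \<and> f (g i) (g j) = b))"
proof -
  obtain h where h: "bij_betw h P {..<card P}"
    using ex_bij_betw_finite_nat[OF assms] by (auto simp: atLeast0LessThan)
  obtain N :: nat where N: "partn_lst {..<N} (replicate (card P) m) 2"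
    using ramsey_full by blast
  show ?thesis
  proof (intro exI[of _ N] allI impI)
    fix f :: "nat \<Rightarrow> nat \<Rightarrow> 'b" assume f: "\<forall>i j. f i j \<in> P"
    let ?F = "\<lambda>e. h (f (Min e) (Max e))"
    have "?F \<in> [{..<N}]\<^bsup>2\<^esup> \<rightarrow> {..<card P}"
      using h f by (auto simp: bij_betw_def)
    then obtain a H where a: "a < card P" and H: "H \<in> [{..<N}]\<^bsup>m\<^esup>" and mono: "?F ` [H]\<^bsup>2\<^esup> \<subseteq> {a}"
      using partn_lstE[OF N, of ?F "card P"] by auto
    have "finite H" "card H = m" "H \<subseteq> {..<N}" using H by (auto simp: nsets_def)
    define g where "g = nth (sorted_list_of_set H)"
    have gH: "g i \<in> H" if "i < m" for i
      using that \<open>finite H\<close> \<open>card H = m\<close> unfolding g_def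
      by (metis nth_mem set_sorted_list_of_set sorted_list_of_set.length_sorted_key_list_of_set)
    have g_less: "g i < g j" if "i < j" "j < m" for i j
      using that \<open>finite H\<close> \<open>card H = m\<close> strict_sorted_list_of_set[of H] unfolding g_def
      by (simp add: sorted_wrt_nth_less)
    show "\<exists>g b. (\<forall>i<m. g i < N) \<and> (\<forall>i j. i < j \<and> j < m \<longrightarrow> g i < g j \<and> f (g i) (g j) = b)"
    proof (intro exI conjI allI impI; (elim conjE)?)
      show "g i < N" if "i < m" for i using gH[OF that] \<open>H \<subseteq> {..<N}\<close> by auto
      fix i j assume ij: "i < j" "j < m"
      show "g i < g j" by (rule g_less[OF ij])
      have "{g i, g j} \<in> [H]\<^bsup>2\<^esup>" using gH ij g_less[OF ij] by auto
      then have "?F {g i, g j} = a" using mono by blast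
      then have "h (f (g i) (g j)) = a" using g_less[OF ij] by simp
      then show "f (g i) (g j) = inv_into P h a"
        using f h by (metis bij_betw_def inv_into_f_f)
    qed
  qed
qed

text \<open>Ramsey's theorem is applied to the copy indices. Splitting a homogeneous set of indices into
  consecutive blocks, one per part, makes the colour of a cross edge depend on its classes only.\<close>

lemma homogeneous_blowup:
  assumes part: "\<And>c. c < q \<Longrightarrow> part c < r"
  obtains M where "\<And>\<phi> E R. blowup q part L M \<phi> E \<Longrightarrow> \<exists>\<psi> \<rho>. coloured_blowup q part L m \<psi> E R \<rho>"
proof -
  let ?C = "{..<q} \<times> {..<q}"
  have "\<exists>N. \<forall>f :: nat \<Rightarrow> nat \<Rightarrow> (nat \<times> nat) set \<times> (nat \<times> nat) set. (\<forall>i j. f i j \<in> Pow ?C \<times> Pow ?C) \<longrightarrow>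
    (\<exists>g b. (\<forall>i<r * m + 1. g i < N) \<and> (\<forall>i j. i < j \<and> j < r * m + 1 \<longrightarrow> g i < g j \<and> f (g i) (g j) = b))"
    by (rule ramsey_pairs) simp
  then obtain N where N: "\<forall>f :: nat \<Rightarrow> nat \<Rightarrow> (nat \<times> nat) set \<times> (nat \<times> nat) set. (\<forall>i j. f i j \<in> Pow ?C \<times> Pow ?C) \<longrightarrow>
    (\<exists>g b. (\<forall>i<r * m + 1. g i < N) \<and> (\<forall>i j. i < j \<and> j < r * m + 1 \<longrightarrow> g i < g j \<and> f (g i) (g j) = b))" ..
  show thesis
  proof (rule that)
    fix \<phi> E R assume \<phi>: "blowup q part L N \<phi> E"
    \<comment> \<open>The colour of an index pair records which class pairs are red between the
      copies \<open>i\<close> and \<open>j\<close>, and which are red within copy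
      \<open>i\<close>.\<close>
    define f where "f i j = ({(c, d) \<in> ?C. {\<phi> (c, i), \<phi> (d, j)} \<in> R}, {(c, d) \<in> ?C. {\<phi> (c, i), \<phi> (d, i)} \<in> R})" for i j
    have "f i j \<in> Pow ?C \<times> Pow ?C" for i j by (auto simp: f_def)
    then have "\<exists>g b. (\<forall>i<r * m + 1. g i < N) \<and> (\<forall>i j. i < j \<and> j < r * m + 1 \<longrightarrow> g i < g j \<and> f (g i) (g j) = b)"
      using N by (simp del: Pow_iff)
    then obtain g \<Gamma> \<Delta> where g: "\<And>i. i < r * m + 1 \<Longrightarrow> g i < N"
        "\<And>i j. i < j \<Longrightarrow> j < r * m + 1 \<Longrightarrow> g i < g j" "\<And>i j. i < j \<Longrightarrow> j < r * m + 1 \<Longrightarrow> f (g i) (g j) = (\<Gamma>, \<Delta>)"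
      by (metis (no_types, lifting) surj_pair)
    have g_eq: "g i = g j \<longleftrightarrow> i = j" if "i < r * m + 1" "j < r * m + 1" for i j
      using g(2) that by (metis linorder_neqE_nat less_irrefl)
    \<comment> \<open>The block of \<open>c\<close> depends on its part only: classes of one part
      keep equal copies equal, so links survive, and indices of different parts are ordered like the
      parts.\<close>
    define t where "t c j = part c * m + j" for c j
    have t_bound: "t c j < r * m" if "c < q" "j < m" for c j
    proof -
      have "t c j < Suc (part c) * m" using that by (simp add: t_def)
      also have "\<dots> \<le> r * m" using part[OF that(1)] by (intro mult_le_mono1) simp
      finally show ?thesis .
    qed
    have t_less: "t c i < t d j" if "part c < part d" "i < m" for c d i j
    proof -
      have "t c i < Suc (part c) * m" using that by (simp add: t_def)
      also have "\<dots> \<le> part d * m" using that by (intro mult_le_mono1) simp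
      finally show ?thesis by (simp add: t_def)
    qed
    define \<psi> where "\<psi> v = \<phi> (fst v, g (t (fst v) (snd v)))" for v
    \<comment> \<open>\<open>\<Gamma>\<close> is meaningful with the class of the lower part first.
      Within a part, the disjunction makes \<open>\<rho>\<close> symmetric by definition.\<close>
    define \<rho> where "\<rho> c d \<longleftrightarrow> (if part c < part d then (c, d) \<in> \<Gamma>
      else if part d < part c then (d, c) \<in> \<Gamma> else (c, d) \<in> \<Delta> \<or> (d, c) \<in> \<Delta>)" for c d
    have inj: "inj_on \<phi> ({..<q} \<times> {..<N})"
      and cross: "\<And>c d i j. c < q \<Longrightarrow> d < q \<Longrightarrow> part c \<noteq> part d \<Longrightarrow> i < N \<Longrightarrow> j < N \<Longrightarrow> {\<phi> (c, i), \<phi> (d, j)} \<in> E"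
      and links: "\<And>c d j. c < q \<Longrightarrow> d < q \<Longrightarrow> (c, d) \<in> L \<Longrightarrow> j < N \<Longrightarrow> {\<phi> (c, j), \<phi> (d, j)} \<in> E"
      using \<phi> unfolding blowup_def by auto
    have gt: "g (t c j) < N" if "c < q" "j < m" for c j
      using g(1) t_bound[OF that] by simp
    have "blowup q part L m \<psi> E"
      unfolding blowup_def
    proof (intro conjI allI impI)
      show "inj_on \<psi> ({..<q} \<times> {..<m})"
      proof (rule inj_onI, clarsimp simp: \<psi>_def)
        fix c i d j assume *: "c < q" "i < m" "d < q" "j < m" "\<phi> (c, g (t c i)) = \<phi> (d, g (t d j))"
        then have "(c, g (t c i)) = (d, g (t d j))"
          using inj gt by (intro inj_onD[OF inj]) auto
        then have "c = d" "t c i = t d j"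
          using g_eq t_bound * by (auto simp: less_SucI)
        then show "c = d \<and> i = j" by (simp add: t_def)
      qed
    next
      fix c d i j assume "c < q" "d < q" "part c \<noteq> part d" "i < m" "j < m"
      then show "{\<psi> (c, i), \<psi> (d, j)} \<in> E" using cross gt by (simp add: \<psi>_def)
    next
      fix c d j assume *: "c < q" "d < q" "(c, d) \<in> L" "j < m"
      show "{\<psi> (c, j), \<psi> (d, j)} \<in> E"
      proof (cases "part c = part d")
        case True
        then have "t c j = t d j" by (simp add: t_def)
        then show ?thesis using links * gt by (simp add: \<psi>_def)
      qed (use cross gt * in \<open>simp add: \<psi>_def\<close>)
    qed
    moreover have ordered: "{\<psi> (c, i), \<psi> (d, j)} \<in> R \<longleftrightarrow> (c, d) \<in> \<Gamma>"
      if "c < q" "d < q" "part c < part d" "i < m" "j < m" for c d i j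
    proof -
      have "f (g (t c i)) (g (t d j)) = (\<Gamma>, \<Delta>)"
        using g(3) t_less that t_bound by (simp add: less_SucI)
      then show ?thesis using that by (auto simp: f_def \<psi>_def)
    qed
    moreover have "{\<psi> (c, i), \<psi> (d, j)} \<in> R \<longleftrightarrow> \<rho> c d"
      if "c < q" "d < q" "part c \<noteq> part d" "i < m" "j < m" for c d i j
      using ordered[of c d i j] ordered[of d c j i] that by (auto simp: \<rho>_def insert_commute)
    moreover have "{\<psi> (c, j), \<psi> (d, j)} \<in> R \<longleftrightarrow> \<rho> c d"
      if "c < q" "d < q" "part c = part d" "j < m" for c d j
    proof -
      have t: "t d j = t c j" using that by (simp add: t_def)
      \<comment> \<open>The spare top index \<open>r * m\<close> is a larger partner for every index
        in use, including the last one of the last block.\<close>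
      have "f (g (t c j)) (g (r * m)) = (\<Gamma>, \<Delta>)"
        using g(3) that t_bound by simp
      then show ?thesis using that t by (auto simp: f_def \<psi>_def \<rho>_def insert_commute)
    qed
    moreover have "\<rho> c d \<longleftrightarrow> \<rho> d c" for c d by (auto simp: \<rho>_def)
    ultimately have "coloured_blowup q part L m \<psi> E R \<rho>"
      by unfold_locales
    then show "\<exists>\<psi> \<rho>. coloured_blowup q part L m \<psi> E R \<rho>" by blast
  qed
qed

text \<open>\<open>forces\<close> speaks of homogeneous colourings only; any colouring of a
  sufficiently large blow-up contains a homogeneous one.\<close>

lemma ramsey_blowup:
  assumes "forces q part L k l" "\<And>c. c < q \<Longrightarrow> part c < r"
  obtains M where "\<And>\<phi> E. blowup q part L M \<phi> E \<Longrightarrow> cycle_ramsey k l E"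
proof -
  obtain m where m: "\<And>\<phi> E R \<rho>. R \<subseteq> E \<Longrightarrow> coloured_blowup q part L m \<phi> E R \<rho> \<Longrightarrow> has_cycle k R \<or> has_cycle l (E - R)"
    using assms(1) unfolding forces_def by blast
  show thesis
  proof (rule homogeneous_blowup[of q part r L m])
    fix M assume M: "\<And>\<phi> E R. blowup q part L M \<phi> E \<Longrightarrow> \<exists>\<psi> \<rho>. coloured_blowup q part L m \<psi> E R \<rho>"
    show thesis
    proof (rule that[of M], unfold cycle_ramsey_def, intro allI impI)
      fix \<phi> E R assume "blowup q part L M \<phi> E" "R \<subseteq> E"
      with M[of \<phi> E R] m[of R E] show "has_cycle k R \<or> has_cycle l (E - R)" by metis
    qed
  qed (fact assms(2))
qed

section \<open>Supersaturation\<close>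

text \<open>Copies of the complete multipartite graph on \<open>V\<close>; vertices of the same part may coincide.\<close>

definition homs :: "nat set \<Rightarrow> nat set set \<Rightarrow> ('v \<Rightarrow> nat) \<Rightarrow> 'v set \<Rightarrow> ('v \<Rightarrow> nat) set" where
  "homs W E part V = {x \<in> V \<rightarrow>\<^sub>E W. \<forall>u\<in>V. \<forall>v\<in>V. part u \<noteq> part v \<longrightarrow> {x u, x v} \<in> E}"

definition extensions :: "nat set \<Rightarrow> nat set set \<Rightarrow> ('v \<Rightarrow> nat) \<Rightarrow> 'v set \<Rightarrow> 'v \<Rightarrow> ('v \<Rightarrow> nat) \<Rightarrow> nat set" where
  "extensions W E part V v z = {y \<in> W. \<forall>u\<in>V. part u \<noteq> part v \<longrightarrow> {z u, y} \<in> E}"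

lemma finite_homs: "finite W \<Longrightarrow> finite V \<Longrightarrow> finite (homs W E part V)"
  unfolding homs_def by (rule finite_subset[of _ "V \<rightarrow>\<^sub>E W"]) (auto intro: finite_PiE)

lemma finite_extensions: "finite W \<Longrightarrow> finite (extensions W E part V v z)"
  by (simp add: extensions_def)

lemma card_homs_le: "finite W \<Longrightarrow> finite V \<Longrightarrow> card (homs W E part V) \<le> card W ^ card V"
  using card_mono[of "V \<rightarrow>\<^sub>E W" "homs W E part V"] by (auto simp: homs_def card_PiE finite_PiE)

text \<open>A copy of the larger vertex set is a copy of \<open>V\<close> together with an
  admissible image of \<open>v\<close>. The weight \<open>g\<close> is needed for twins, where it
  counts the images of the second twin.\<close>

lemma sum_homs_insert:
  fixes g :: "('v \<Rightarrow> nat) \<Rightarrow> nat"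
  assumes "finite W" "finite V" "v \<notin> V"
  shows "(\<Sum>x\<in>homs W E part (insert v V). g x) =
    (\<Sum>z\<in>homs W E part V. \<Sum>y\<in>extensions W E part V v z. g (z(v := y)))"
proof -
  let ?S = "SIGMA z:homs W E part V. extensions W E part V v z"
  let ?f = "\<lambda>(z, y). z(v := y) :: 'v \<Rightarrow> nat"
  have inj: "inj_on ?f ?S"
  proof (rule inj_onI, clarsimp)
    fix z y z' y' assume *: "z \<in> homs W E part V" "z' \<in> homs W E part V" "z(v := y) = z'(v := y')"
    have "z x = z' x" for x
    proof (cases "x = v")
      case True
      then show ?thesis using * assms by (auto simp: homs_def PiE_def extensional_def)
    qed (use * in \<open>metis fun_upd_apply\<close>)
    then show "z = z' \<and> y = y'" using * by (metis ext fun_upd_same)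
  qed
  have "homs W E part (insert v V) = ?f ` ?S"
  proof (intro set_eqI iffI)
    fix x assume x: "x \<in> homs W E part (insert v V)"
    let ?z = "restrict x V"
    have "?z \<in> homs W E part V" using x by (auto simp: homs_def)
    moreover have "x v \<in> extensions W E part V v ?z" using x by (auto simp: homs_def extensions_def)
    moreover have "x = ?z(v := x v)"
      using x by (auto simp: homs_def PiE_def extensional_def fun_eq_iff)
    ultimately show "x \<in> ?f ` ?S" by (intro image_eqI[of _ _ "(?z, x v)"]) auto
  next
    fix x assume "x \<in> ?f ` ?S"
    then obtain z y where "x = z(v := y)" "z \<in> homs W E part V" "y \<in> extensions W E part V v z" by auto
    then show "x \<in> homs W E part (insert v V)" using assms
      by (auto simp: homs_def extensions_def PiE_def extensional_def insert_commute)
  qed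
  then have "(\<Sum>x\<in>homs W E part (insert v V). g x) = (\<Sum>p\<in>?S. g (?f p))"
    using sum.reindex[OF inj, of g] by (simp add: comp_def)
  also have "\<dots> = (\<Sum>z\<in>homs W E part V. \<Sum>y\<in>extensions W E part V v z. g (z(v := y)))"
    using assms finite_homs finite_extensions by (subst sum.Sigma) (auto simp: case_prod_unfold)
  finally show ?thesis .
qed

lemma card_homs_insert:
  assumes "finite W" "finite V" "v \<notin> V"
  shows "card (homs W E part (insert v V)) = (\<Sum>z\<in>homs W E part V. card (extensions W E part V v z))"
  using sum_homs_insert[OF assms, of "\<lambda>_. 1"] by simp

text \<open>If \<open>u\<close> and \<open>v\<close> are twins then \<open>V\<close> has as many copies as there are pairs of copies of \<open>V - {v}\<close>
  agreeing outside \<open>u\<close>, so that the Cauchy--Schwarz inequality applies.\<close>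

lemma card_homs_twin:
  assumes "finite W" "finite Z" "u \<notin> Z" "v \<notin> Z" "u \<noteq> v" "part u = part v"
  shows "card (homs W E part (insert u Z)) ^ 2
    \<le> card W ^ card Z * card (homs W E part (insert v (insert u Z)))"
proof -
  let ?a = "\<lambda>z. card (extensions W E part Z u z)"
  \<comment> \<open>The twin \<open>u\<close> imposes no condition on \<open>v\<close>, and every
    other vertex constrains both alike.\<close>
  have ext: "extensions W E part (insert u Z) v (z(u := y)) = extensions W E part Z u z" for z y
    using assms by (auto simp: extensions_def)
  have "card (homs W E part (insert v (insert u Z))) =
      (\<Sum>x\<in>homs W E part (insert u Z). card (extensions W E part (insert u Z) v x))"
    using assms by (intro card_homs_insert) auto
  also have "\<dots> = (\<Sum>z\<in>homs W E part Z. ?a z ^ 2)"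
    using assms by (subst sum_homs_insert) (auto simp: ext power2_eq_square)
  finally have sq: "card (homs W E part (insert v (insert u Z))) = (\<Sum>z\<in>homs W E part Z. ?a z ^ 2)" .
  have "real (card (homs W E part (insert u Z)) ^ 2) = (\<Sum>z\<in>homs W E part Z. real (?a z)) ^ 2"
    using assms by (simp add: card_homs_insert)
  also have "\<dots> \<le> real (card (homs W E part Z)) * (\<Sum>z\<in>homs W E part Z. real (?a z) ^ 2)"
    using sum_squared_le_sum_of_squares[of "\<lambda>z. real (?a z)" "homs W E part Z"]
      finite_homs[OF assms(1,2), of E part] by (simp add: mult.commute)
  also have "\<dots> = real (card (homs W E part Z) * card (homs W E part (insert v (insert u Z))))"
    by (simp add: sq)
  also have "\<dots> \<le> real (card W ^ card Z * card (homs W E part (insert v (insert u Z))))"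
    using card_homs_le[OF assms(1,2), of E part] by (intro of_nat_mono mult_le_mono1)
  finally show ?thesis by linarith
qed

definition common_nbrs :: "nat set \<Rightarrow> nat set set \<Rightarrow> nat set \<Rightarrow> nat set" where
  "common_nbrs W E X = {y \<in> W. \<forall>x\<in>X. {x, y} \<in> E}"

text \<open>The hypothesis of a greedy embedding: up to \<open>s\<close> chosen vertices leave a
  proportion \<open>c\<close> of \<open>W\<close> as candidates for the next one.\<close>

definition locally_dense :: "nat \<Rightarrow> real \<Rightarrow> nat set \<Rightarrow> nat set set \<Rightarrow> bool" where
  "locally_dense s c W E \<longleftrightarrow> finite W \<and>
    (\<forall>X\<subseteq>W. card X \<le> s \<longrightarrow> c * real (card W) \<le> real (card (common_nbrs W E X)))"

text \<open>Induction on the number of vertices. If all parts are distinct, a vertex is added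
  greedily, having at most \<open>s\<close> predecessors, which multiplies the constant by
  \<open>c\<close>. Otherwise there are twins, and the Cauchy-Schwarz bound squares the
  constant.\<close>

lemma many_homs:
  fixes part :: "'v \<Rightarrow> nat" and c :: real
  assumes "finite V" "part ` V \<subseteq> {..s}" "0 < c"
  shows "\<exists>\<kappa>>0. \<forall>W E. locally_dense s c W E \<longrightarrow>
    \<kappa> * real (card W) ^ card V \<le> real (card (homs W E part V))"
  using assms(1,2)
proof (induction "card V" arbitrary: V rule: less_induct)
  case less
  show ?case
  proof (cases "inj_on part V")
    case inj: True
    show ?thesis
    proof (cases "V = {}")
      case True
      then show ?thesis by (intro exI[of _ 1]) (auto simp: homs_def)
    next
      case False
      then obtain v V' where V: "V = insert v V'" "v \<notin> V'" by (meson mk_disjoint_insert equals0I)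
      have fin: "finite V'" using less.prems V by simp
      obtain \<kappa> :: real where \<kappa>: "\<kappa> > 0" "\<And>W E. locally_dense s c W E \<Longrightarrow>
          \<kappa> * real (card W) ^ card V' \<le> real (card (homs W E part V'))"
        using less.hyps[of V'] less.prems V by (auto simp: less_Suc_eq)
      have "card V \<le> card {..s}"
        using inj less.prems by (metis card_image card_mono finite_atMost)
      then have card: "card V' \<le> s" using V fin by simp
      show ?thesis
      proof (intro exI[of _ "\<kappa> * c"] conjI allI impI)
        show "0 < \<kappa> * c" using \<kappa> assms by simp
        fix W E assume dense: "locally_dense s c W E"
        then have W: "finite W" and nbrs: "\<forall>X\<subseteq>W. card X \<le> s \<longrightarrow> c * card W \<le> card (common_nbrs W E X)"
          by (auto simp: locally_dense_def)
        have ext: "c * card W \<le> card (extensions W E part V' v z)" if z: "z \<in> homs W E part V'" for z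
        proof -
          have "z ` V' \<subseteq> W" using z by (auto simp: homs_def)
          moreover have "card (z ` V') \<le> s" using card card_image_le[OF fin, of z] by simp
          ultimately have "c * card W \<le> card (common_nbrs W E (z ` V'))" using nbrs by blast
          also have "\<dots> \<le> card (extensions W E part V' v z)"
            using W by (intro of_nat_mono card_mono) (auto simp: common_nbrs_def extensions_def)
          finally show ?thesis .
        qed
        have "\<kappa> * c * real (card W) ^ card V = (\<kappa> * real (card W) ^ card V') * (c * card W)"
          using V fin by simp
        also have "\<dots> \<le> card (homs W E part V') * (c * card W)"
          using \<kappa>(2)[OF dense] assms by (intro mult_right_mono) auto
        also have "\<dots> = (\<Sum>z\<in>homs W E part V'. c * card W)" by simp
        also have "\<dots> \<le> (\<Sum>z\<in>homs W E part V'. real (card (extensions W E part V' v z)))"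
          by (intro sum_mono ext)
        also have "\<dots> = card (homs W E part V)"
          using card_homs_insert[OF W fin V(2), of E part] V by simp
        finally show "\<kappa> * c * real (card W) ^ card V \<le> card (homs W E part V)" .
      qed
    qed
  next
    case False
    then obtain u v where uv: "u \<in> V" "v \<in> V" "u \<noteq> v" "part u = part v" by (auto simp: inj_on_def)
    define Z where "Z = V - {u, v}"
    have V: "V = insert v (insert u Z)" and Z: "finite Z" "u \<notin> Z" "v \<notin> Z"
      using uv less.prems by (auto simp: Z_def)
    have cV: "card V = Suc (Suc (card Z))" using V Z uv by simp
    obtain \<kappa> :: real where \<kappa>: "\<kappa> > 0" "\<And>W E. locally_dense s c W E \<Longrightarrow>
        \<kappa> * real (card W) ^ card (insert u Z) \<le> real (card (homs W E part (insert u Z)))"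
      using less.hyps[of "insert u Z"] less.prems V Z cV by auto
    show ?thesis
    proof (intro exI[of _ "\<kappa> ^ 2"] conjI allI impI)
      show "0 < \<kappa> ^ 2" using \<kappa> by simp
      fix W E assume dense: "locally_dense s c W E"
        then have W: "finite W" and nbrs: "\<forall>X\<subseteq>W. card X \<le> s \<longrightarrow> c * card W \<le> card (common_nbrs W E X)"
          by (auto simp: locally_dense_def)
      let ?w = "real (card W)"
      show "\<kappa> ^ 2 * real (card W) ^ card V \<le> card (homs W E part V)"
      proof (cases "card W = 0")
        case True
        then show ?thesis by (simp add: cV)
      next
        case False
        \<comment> \<open>The factor \<open>?w ^ card Z\<close> is cancelled at the end, hence the
          separate case of empty \<open>W\<close>.\<close>
        have "?w ^ card Z * (\<kappa> ^ 2 * ?w ^ card V) = (\<kappa> * ?w ^ card (insert u Z)) ^ 2"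
          using Z cV by (simp add: power_mult_distrib power2_eq_square algebra_simps)
        also have "\<dots> \<le> real (card (homs W E part (insert u Z))) ^ 2"
          using \<kappa>(2)[OF dense] \<kappa>(1) by (intro power_mono) auto
        also have "\<dots> \<le> ?w ^ card Z * card (homs W E part V)"
          using card_homs_twin[OF W Z, of part E] uv unfolding V
          by (metis of_nat_le_iff of_nat_mult of_nat_power)
        finally show ?thesis using False by simp
      qed
    qed
  qed
qed

section \<open>Subsets of large minimum degree and injective copies\<close>

definition edges_in :: "nat set set \<Rightarrow> nat set \<Rightarrow> nat set set" where
  "edges_in E W = {e \<in> E. e \<subseteq> W}"

lemma finite_all_pairs [simp]: "finite (all_pairs n)"
  by (rule finite_subset[of _ "Pow {..<n}"]) (auto simp: all_pairs_def)

lemma edge_subset: "graph_on n E \<Longrightarrow> e \<in> E \<Longrightarrow> e \<subseteq> {..<n}"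
  by (auto simp: graph_on_def all_pairs_def)

lemma graph_edgeE:
  assumes "graph_on n E" "e \<in> E" obtains x y where "x \<noteq> y" "e = {x, y}"
  using assms by (auto simp: graph_on_def all_pairs_def)

lemma finite_graph: "graph_on n E \<Longrightarrow> finite E"
  unfolding graph_on_def using finite_subset[OF _ finite_all_pairs] by blast

lemma edges_in_remove:
  assumes E: "graph_on n E" and "x \<in> W" "finite W"
  shows "card (edges_in E W) = card (edges_in E (W - {x})) + card (common_nbrs W E {x})"
proof -
  have disj: "edges_in E (W - {x}) \<inter> (\<lambda>y. {x, y}) ` common_nbrs W E {x} = {}"
    by (auto simp: edges_in_def)
  have "edges_in E W = edges_in E (W - {x}) \<union> (\<lambda>y. {x, y}) ` common_nbrs W E {x}"
  proof (intro equalityI subsetI)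
    fix e assume e: "e \<in> edges_in E W"
    then obtain a b where "a \<noteq> b" "e = {a, b}" using graph_edgeE[OF E] by (auto simp: edges_in_def)
    then show "e \<in> edges_in E (W - {x}) \<union> (\<lambda>y. {x, y}) ` common_nbrs W E {x}"
      using e by (auto simp: edges_in_def common_nbrs_def insert_commute)
  qed (use assms in \<open>auto simp: edges_in_def common_nbrs_def\<close>)
  moreover have "inj_on (\<lambda>y. {x, y}) (common_nbrs W E {x})"
    by (auto simp: inj_on_def doubleton_eq_iff)
  ultimately show ?thesis
    using disj finite_graph[OF E] assms
    by (simp add: card_Un_disjoint card_image edges_in_def common_nbrs_def)
qed

lemma card_edges_in_le:
  assumes E: "graph_on n E" and "finite W"
  shows "card (edges_in E W) \<le> card W ^ 2"
proof -
  have "edges_in E W \<subseteq> (\<lambda>(x, y). {x, y}) ` (W \<times> W)"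
  proof
    fix e assume e: "e \<in> edges_in E W"
    then obtain a b where "a \<noteq> b" "e = {a, b}" using graph_edgeE[OF E] by (auto simp: edges_in_def)
    then show "e \<in> (\<lambda>(x, y). {x, y}) ` (W \<times> W)" using e by (auto simp: edges_in_def)
  qed
  then have "card (edges_in E W) \<le> card (W \<times> W)"
    using assms by (meson card_image_le card_mono finite_SigmaI finite_imageI le_trans)
  then show ?thesis by (simp add: card_cartesian_product power2_eq_square)
qed

lemma real_choose_2: "real (n choose 2) = real n * (real n - 1) / 2"
proof -
  have "even (n * (n - 1))" by (cases n) auto
  then have "2 * (n choose 2) = n * (n - 1)" by (simp add: choose_two)
  then have "2 * real (n choose 2) = real n * real (n - 1)" by (metis of_nat_mult of_nat_numeral)
  then show ?thesis by (cases n) auto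
qed

text \<open>A vertex set maximising \<open>e(W) - \<alpha> |W|\<^sup>2 / 2\<close> has large minimum degree, because deleting a
  vertex does not increase this quantity.\<close>

lemma dense_subset:
  fixes d \<alpha> :: real
  assumes "0 < \<alpha>" "\<alpha> < d" and n: "n \<ge> 2" "real n * (d - \<alpha>) \<ge> 2 * d"
    and E: "graph_on n E" "d \<le> density n E"
  obtains W where "W \<subseteq> {..<n}" "(d - \<alpha>) / 4 * n \<le> card W"
    "\<And>x. x \<in> W \<Longrightarrow> \<alpha> * (card W - 1/2) \<le> card (common_nbrs W E {x})"
proof -
  define f where "f W = real (card (edges_in E W)) - \<alpha> * real (card W) ^ 2 / 2" for W
  obtain W where W: "W \<subseteq> {..<n}" and max: "\<And>U. U \<subseteq> {..<n} \<Longrightarrow> f U \<le> f W"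
  proof -
    have "finite (f ` Pow {..<n})" "f ` Pow {..<n} \<noteq> {}" by auto
    then obtain W where "W \<in> Pow {..<n}" "f W = Max (f ` Pow {..<n})"
      using Max_in[of "f ` Pow {..<n}"] by (metis imageE)
    then show thesis using that[of W] by auto
  qed
  have finW: "finite W" using W finite_subset by blast
  show thesis
  proof (rule that[OF W])
    \<comment> \<open>The maximum is compared with the value at the whole vertex set. As
      \<open>W\<close> spans at most \<open>card W ^ 2\<close>, hence at most
      \<open>n * card W\<close> edges, it cannot be small.\<close>
    have "edges_in E {..<n} = E" using edge_subset[OF E(1)] by (auto simp: edges_in_def)
    then have "card E - \<alpha> * real n ^ 2 / 2 \<le> f W" using max[of "{..<n}"] by (simp add: f_def)
    also have "f W \<le> card (edges_in E W)" using assms by (simp add: f_def)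
    also have "\<dots> \<le> real (card W ^ 2)" using card_edges_in_le[OF E(1) finW] by (intro of_nat_mono)
    also have "\<dots> = real (card W) * card W" by (simp add: power2_eq_square)
    also have "\<dots> \<le> real n * card W"
      using card_mono[OF _ W] by (intro mult_right_mono) auto
    finally have 1: "card E - \<alpha> * real n ^ 2 / 2 \<le> real n * card W" .
    have "d * (n choose 2) \<le> card E" using E n by (simp add: density_def field_simps)
    then have "d * (real n * (real n - 1) / 2) - \<alpha> * real n ^ 2 / 2 \<le> real n * card W"
      using 1 unfolding real_choose_2 by linarith
    moreover have "d * (real n * (real n - 1) / 2) - \<alpha> * real n ^ 2 / 2
      = real n * ((d - \<alpha>) / 2 * n - d / 2)"
      by (simp add: power2_eq_square algebra_simps diff_divide_distrib)
    ultimately have "(d - \<alpha>) / 2 * n - d / 2 \<le> card W" using n by simp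
    \<comment> \<open>The lower bound on \<open>n\<close> lets half of the main term absorb
      \<open>d / 2\<close>.\<close>
    moreover have "d / 2 \<le> (d - \<alpha>) / 4 * n" using n by (simp add: algebra_simps)
    ultimately show "(d - \<alpha>) / 4 * n \<le> card W" by (simp add: algebra_simps)
  next
    fix x assume x: "x \<in> W"
    have "card W \<ge> 1" using x finW by (metis One_nat_def Suc_leI card_gt_0_iff empty_iff)
    \<comment> \<open>The difference of the squares of \<open>card W\<close> and
      \<open>card W - 1\<close> is \<open>2 * card W - 1\<close>, the source of the
      \<open>1/2\<close> in the degree bound.\<close>
    have "f (W - {x}) \<le> f W" using W by (intro max) auto
    then have "\<alpha> * (real (card W) ^ 2 - (real (card W) - 1) ^ 2) / 2 \<le> card (common_nbrs W E {x})"
      using edges_in_remove[OF E(1) x finW] x finW \<open>card W \<ge> 1\<close>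
      by (simp add: f_def of_nat_diff algebra_simps diff_divide_distrib)
    then show "\<alpha> * (card W - 1/2) \<le> card (common_nbrs W E {x})"
      by (simp add: power2_eq_square algebra_simps)
  qed
qed

text \<open>Every vertex of \<open>X\<close> excludes at most \<open>\<beta>\<close> vertices of
  \<open>W\<close>.\<close>

lemma card_common_nbrs:
  fixes \<beta> :: real
  assumes "finite W" "finite X" and "\<And>x. x \<in> X \<Longrightarrow> card W - \<beta> \<le> card (common_nbrs W E {x})"
  shows "card W - card X * \<beta> \<le> card (common_nbrs W E X)"
  using assms(2,3)
proof (induction X)
  case (insert x X)
  let ?A = "common_nbrs W E {x}" and ?B = "common_nbrs W E X"
  have fin: "finite ?A" "finite ?B" using assms by (auto simp: common_nbrs_def)
  have "card (?A \<union> ?B) \<le> card W" using assms by (intro card_mono) (auto simp: common_nbrs_def)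
  then have "card ?A + card ?B \<le> card W + card (?A \<inter> ?B)" using card_Un_Int[OF fin] by linarith
  moreover have "?A \<inter> ?B = common_nbrs W E (insert x X)" by (auto simp: common_nbrs_def)
  ultimately have "real (card ?A) + card ?B \<le> card W + card (common_nbrs W E (insert x X))"
    by (metis of_nat_add of_nat_le_iff)
  moreover have "card W - card X * \<beta> \<le> card ?B" by (rule insert.IH) (simp add: insert.prems)
  moreover have "card W - \<beta> \<le> card ?A" by (rule insert.prems) simp
  moreover have "card (insert x X) * \<beta> = card X * \<beta> + \<beta>" using insert.hyps by (simp add: algebra_simps)
  ultimately show ?case by linarith
qed (simp add: common_nbrs_def)

text \<open>Union bound over the colliding pairs: a map with \<open>x u = x v\<close> is determined
  by its values off \<open>v\<close>.\<close>

lemma card_not_inj: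
  assumes "finite V" "finite A"
  shows "card {x \<in> V \<rightarrow>\<^sub>E A. \<not> inj_on x V} \<le> card V ^ 2 * card A ^ (card V - 1)"
proof -
  let ?B = "\<lambda>(u, v). {x \<in> V \<rightarrow>\<^sub>E A. x u = x v}"
  let ?P = "{(u, v) \<in> V \<times> V. u \<noteq> v}"
  have B: "card (?B p) \<le> card A ^ (card V - 1)" if p: "p \<in> ?P" for p
  proof -
    obtain u v where uv: "p = (u, v)" "u \<in> V" "v \<in> V" "u \<noteq> v" using p by auto
    have "inj_on (\<lambda>x. restrict x (V - {v})) (?B p)"
    proof (rule inj_onI)
      fix x y assume x: "x \<in> ?B p" and y: "y \<in> ?B p" and eq: "restrict x (V - {v}) = restrict y (V - {v})"
      have *: "x w = y w" if "w \<in> V - {v}" for w using fun_cong[OF eq, of w] that by simp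
      show "x = y"
      proof
        fix w
        show "x w = y w"
          using * x y uv by (cases "w \<in> V - {v}"; cases "w = v") (auto simp: PiE_def extensional_def)
      qed
    qed
    moreover have "(\<lambda>x. restrict x (V - {v})) ` ?B p \<subseteq> (V - {v}) \<rightarrow>\<^sub>E A"
      using uv by (auto simp: PiE_iff split: if_splits)
    ultimately have "card (?B p) \<le> card ((V - {v}) \<rightarrow>\<^sub>E A)"
      using assms by (intro card_inj_on_le) (auto intro: finite_PiE)
    then show ?thesis using assms uv by (simp add: card_PiE)
  qed
  have "{x \<in> V \<rightarrow>\<^sub>E A. \<not> inj_on x V} \<subseteq> (\<Union>p\<in>?P. ?B p)" by (auto simp: inj_on_def)
  moreover have finP: "finite ?P" using assms by (intro finite_subset[of ?P "V \<times> V"]) auto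
  moreover have "finite (?B p)" for p
    using assms by (cases p) (auto intro!: finite_subset[OF _ finite_PiE[of V "\<lambda>_. A"]])
  ultimately have "card {x \<in> V \<rightarrow>\<^sub>E A. \<not> inj_on x V} \<le> card (\<Union>p\<in>?P. ?B p)"
    by (intro card_mono) auto
  also have "\<dots> \<le> (\<Sum>p\<in>?P. card (?B p))" by (rule card_UN_le[OF finP])
  also have "\<dots> \<le> (\<Sum>p\<in>?P. card A ^ (card V - 1))" by (intro sum_mono B)
  also have "\<dots> = card ?P * card A ^ (card V - 1)" by simp
  also have "card ?P \<le> card (V \<times> V)" using assms by (intro card_mono) auto
  finally show ?thesis by (simp add: card_cartesian_product power2_eq_square)
qed

text \<open>Above the Turan density there is a set \<open>W\<close> of linear size in which any
  \<open>s\<close> vertices have linearly many common neighbours, so a positive proportion of all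
  maps are copies. The non-injective maps are fewer by a factor of order \<open>n\<close> and cost
  half of the constant.\<close>

lemma supersaturation:
  fixes part :: "'v \<Rightarrow> nat" and d :: real
  assumes "s \<ge> 1" and d: "1 - 1 / s < d" and V: "finite V" "part ` V \<subseteq> {..s}"
  shows "\<exists>\<kappa>>0. \<exists>N. \<forall>n\<ge>N. \<forall>E. graph_on n E \<and> d \<le> density n E \<longrightarrow>
    \<kappa> * real n ^ card V \<le> real (card {x \<in> homs {..<n} E part V. inj_on x V})"
proof -
  have "0 \<le> 1 - 1 / real s" using assms by simp
  \<comment> \<open>The midpoint leaves room on both sides: \<open>\<alpha> < d\<close> gives a
    subset of relative degree \<open>\<alpha>\<close>, and exceeding \<open>1 - 1 / s\<close> makes
    \<open>c\<close> positive.\<close>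
  define \<alpha> where "\<alpha> = (d + (1 - 1 / s)) / 2"
  have \<alpha>: "0 < \<alpha>" "\<alpha> < d" "1 - 1 / s < \<alpha>" using d \<open>0 \<le> 1 - 1 / real s\<close> by (auto simp: \<alpha>_def)
  \<comment> \<open>\<open>s\<close> neighbourhoods of relative size \<open>\<alpha>\<close> share a
    proportion \<open>1 - s * (1 - \<alpha>)\<close>; half of it pays for the additive errors
    \<open>1/2\<close> in the degrees.\<close>
  define c where "c = (1 - s * (1 - \<alpha>)) / 2"
  have c: "0 < c" using \<alpha>(3) assms(1) by (simp add: c_def field_simps)
  obtain \<kappa> where \<kappa>: "\<kappa> > 0"
    and many: "\<And>W E. locally_dense s c W E \<Longrightarrow> \<kappa> * real (card W) ^ card V \<le> real (card (homs W E part V))"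
    using many_homs[OF V c] by blast
  define \<eta> where "\<eta> = (d - \<alpha>) / 4"
  have \<eta>: "\<eta> > 0" using \<alpha> by (simp add: \<eta>_def)
  let ?v = "card V"
  define \<kappa>' where "\<kappa>' = \<kappa> * \<eta> ^ ?v / 2"
  have \<kappa>': "\<kappa>' > 0" using \<kappa> \<eta> by (simp add: \<kappa>'_def)
  \<comment> \<open>In turn: a nontrivial vertex set, the size condition of
    \<open>dense_subset\<close>, the additive errors in common neighbourhoods, and the non-injective
    maps.\<close>
  define N where "N = 2 + nat \<lceil>2 * d / (d - \<alpha>)\<rceil> + nat \<lceil>s / (c * \<eta>)\<rceil> + nat \<lceil>?v ^ 2 / \<kappa>'\<rceil>"
  show ?thesis
  proof (intro exI[of _ \<kappa>'] exI[of _ N] conjI allI impI \<kappa>'; (elim conjE)?)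
    fix n E assume n: "n \<ge> N" and E: "graph_on n E" "d \<le> density n E"
    have n1: "n \<ge> 2" "2 * d / (d - \<alpha>) \<le> n" "s / (c * \<eta>) \<le> n" "?v ^ 2 / \<kappa>' \<le> n"
      using n unfolding N_def by linarith+
    have n2: "2 * d \<le> real n * (d - \<alpha>)" "s \<le> real n * (c * \<eta>)" "?v ^ 2 \<le> real n * \<kappa>'"
      using n1 \<alpha> c \<eta> \<kappa>' by (simp_all add: pos_divide_le_eq)
    obtain W where W: "W \<subseteq> {..<n}" "(d - \<alpha>) / 4 * n \<le> card W"
        "\<And>x. x \<in> W \<Longrightarrow> \<alpha> * (card W - 1/2) \<le> card (common_nbrs W E {x})"
      using dense_subset[OF \<alpha>(1,2) n1(1) n2(1) E] by blast
    have finW: "finite W" using W finite_subset by blast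
    have cW: "\<eta> * n \<le> card W" using W by (simp add: \<eta>_def)
    have sW: "s \<le> card W * c"
    proof -
      have "s \<le> (\<eta> * n) * c" using n2 by (simp add: algebra_simps)
      also have "\<dots> \<le> card W * c" using cW c by (intro mult_right_mono) auto
      finally show ?thesis .
    qed
    have \<alpha>1: "\<alpha> \<le> 1"
    proof -
      have "E \<subseteq> all_pairs n" using E by (simp add: graph_on_def)
      moreover have "all_pairs n \<subseteq> {e. e \<subseteq> {..<n} \<and> card e = 2}" by (auto simp: all_pairs_def)
      ultimately have "card E \<le> card {e. e \<subseteq> {..<n} \<and> card e = 2}" by (intro card_mono) auto
      then have "density n E \<le> 1" using n1 by (simp add: n_subsets density_def)
      then show ?thesis using E \<alpha> by simp
    qed
    have "locally_dense s c W E"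
      unfolding locally_dense_def
    proof (intro conjI allI impI finW)
      fix X assume X: "X \<subseteq> W" "card X \<le> s"
      define \<beta> where "\<beta> = (1 - \<alpha>) * card W + 1 / 2"
      have \<beta>: "0 \<le> \<beta>" using \<alpha>1 by (simp add: \<beta>_def)
      have "c * card W \<le> card W - s * \<beta>"
      proof -
        have "card W - s * \<beta> = 2 * (card W * c) - s / 2" by (simp add: \<beta>_def c_def algebra_simps)
        then show ?thesis using sW by (simp add: mult.commute)
      qed
      also have "\<dots> \<le> card W - card X * \<beta>"
        using X \<beta> by (simp add: mult_right_mono)
      also have "\<dots> \<le> card (common_nbrs W E X)"
      proof (rule card_common_nbrs[OF finW])
        show "finite X" using X finW finite_subset by blast
        fix x assume "x \<in> X"
        have "card W - \<beta> \<le> \<alpha> * (card W - 1/2)" using \<alpha>1 by (simp add: \<beta>_def algebra_simps)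
        also have "\<dots> \<le> card (common_nbrs W E {x})" using W(3) \<open>x \<in> X\<close> X by blast
        finally show "card W - \<beta> \<le> card (common_nbrs W E {x})" .
      qed
      finally show "c * card W \<le> card (common_nbrs W E X)" .
    qed
    from many[OF this] have "\<kappa> * real (card W) ^ ?v \<le> real (card (homs W E part V))" .
    moreover have "\<kappa> * (\<eta> * n) ^ ?v \<le> \<kappa> * real (card W) ^ ?v"
      using cW \<kappa> \<eta> by (intro mult_left_mono power_mono) auto
    moreover have "card (homs W E part V) \<le> card (homs {..<n} E part V)"
      using W V by (intro card_mono finite_homs) (fastforce simp: homs_def)+
    ultimately have homs: "2 * \<kappa>' * real n ^ ?v \<le> card (homs {..<n} E part V)"
      by (simp add: \<kappa>'_def power_mult_distrib)
    let ?I = "{x \<in> homs {..<n} E part V. inj_on x V}" and ?J = "{x \<in> V \<rightarrow>\<^sub>E {..<n}. \<not> inj_on x V}"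
    have "finite (V \<rightarrow>\<^sub>E {..<n})" using V by (intro finite_PiE) auto
    then have fin: "finite ?I" "finite ?J"
      using V finite_homs[of "{..<n}" V] by (auto intro: rev_finite_subset)
    have "card (homs {..<n} E part V) \<le> card (?I \<union> ?J)"
      using fin by (intro card_mono) (auto simp: homs_def)
    also have "\<dots> \<le> card ?I + card ?J" by (rule card_Un_le)
    finally have IJ: "card (homs {..<n} E part V) \<le> card ?I + card ?J" .
    have "real (card ?J) \<le> \<kappa>' * real n ^ ?v"
    proof (cases "V = {}")
      case False
      then have v: "?v \<ge> 1" using V by (simp add: Suc_le_eq card_gt_0_iff)
      have "real (card ?J) \<le> real (?v ^ 2 * n ^ (?v - 1))"
        using card_not_inj[OF V(1), of "{..<n}"] by (intro of_nat_mono) simp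
      also have "\<dots> \<le> (real n * \<kappa>') * real n ^ (?v - 1)"
        using n2 by (simp add: mult_right_mono)
      also have "\<dots> = \<kappa>' * real n ^ ?v" using v by (cases ?v) auto
      finally show ?thesis .
    qed (use \<kappa>' in auto)
    then show "\<kappa>' * real n ^ ?v \<le> real (card ?I)" using homs IJ by linarith
  qed
qed

section \<open>Moments in the binomial random graph\<close>

definition gnp_expect :: "nat \<Rightarrow> real \<Rightarrow> (nat set set \<Rightarrow> real) \<Rightarrow> real" where
  "gnp_expect n p X = (\<Sum>S\<in>Pow (all_pairs n). p ^ card S * (1 - p) ^ (card (all_pairs n) - card S) * X S)"

lemma gnp_prob_conv_expect: "gnp_prob n p P = gnp_expect n p (\<lambda>S. of_bool (P S))"
  unfolding gnp_prob_def gnp_expect_def by (intro sum.cong) auto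

lemma gnp_expect_mono:
  assumes "0 \<le> p" "p \<le> 1" "\<And>S. S \<subseteq> all_pairs n \<Longrightarrow> X S \<le> Y S"
  shows "gnp_expect n p X \<le> gnp_expect n p Y"
  unfolding gnp_expect_def using assms by (intro sum_mono mult_left_mono) auto

lemma gnp_expect_sum: "gnp_expect n p (\<lambda>S. \<Sum>i\<in>I. X i S) = (\<Sum>i\<in>I. gnp_expect n p (X i))"
  unfolding gnp_expect_def by (simp add: sum_distrib_left sum.swap[of _ I])

lemma gnp_expect_cmult: "gnp_expect n p (\<lambda>S. c * X S) = c * gnp_expect n p X"
  unfolding gnp_expect_def by (simp add: sum_distrib_left mult_ac)

lemma gnp_expect_add: "gnp_expect n p (\<lambda>S. X S + Y S) = gnp_expect n p X + gnp_expect n p Y"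
  unfolding gnp_expect_def by (simp add: sum.distrib algebra_simps)

lemma gnp_expect_diff: "gnp_expect n p (\<lambda>S. X S - Y S) = gnp_expect n p X - gnp_expect n p Y"
  unfolding gnp_expect_def by (simp add: sum_subtractf algebra_simps)

lemma sum_bernoulli_weights:
  fixes p :: real
  assumes "finite A"
  shows "(\<Sum>S\<in>Pow A. p ^ card S * (1 - p) ^ (card A - card S)) = 1"
  using assms
proof (induction A)
  case (insert a A)
  let ?w = "\<lambda>S. p ^ card S * (1 - p) ^ (card (insert a A) - card S)"
  have "Pow A \<inter> insert a ` Pow A = {}" using insert by auto
  moreover have "inj_on (insert a) (Pow A)" using insert by (auto simp: inj_on_def)
  ultimately have "(\<Sum>S\<in>Pow (insert a A). ?w S) = (\<Sum>S\<in>Pow A. ?w S) + (\<Sum>S\<in>Pow A. ?w (insert a S))"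
    using insert by (simp add: Pow_insert sum.union_disjoint sum.reindex)
  also have "(\<Sum>S\<in>Pow A. ?w S) = (1 - p) * (\<Sum>S\<in>Pow A. p ^ card S * (1 - p) ^ (card A - card S))"
    unfolding sum_distrib_left
  proof (rule sum.cong)
    fix S assume "S \<in> Pow A"
    then have "card S \<le> card A" using insert by (auto intro: card_mono)
    then show "?w S = (1 - p) * (p ^ card S * (1 - p) ^ (card A - card S))"
      using insert by (simp add: Suc_diff_le)
  qed simp
  also have "(\<Sum>S\<in>Pow A. ?w (insert a S)) = p * (\<Sum>S\<in>Pow A. p ^ card S * (1 - p) ^ (card A - card S))"
    unfolding sum_distrib_left
  proof (rule sum.cong)
    fix S assume "S \<in> Pow A"
    then have "finite S" "a \<notin> S" using insert finite_subset by auto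
    then show "?w (insert a S) = p * (p ^ card S * (1 - p) ^ (card A - card S))"
      using insert by simp
  qed simp
  finally show ?case using insert by simp
qed simp

text \<open>The supersets of \<open>J\<close> are the sets \<open>J \<union> T\<close> with
  \<open>T\<close> among the remaining pairs, and the weights of these \<open>T\<close> sum to
  one.\<close>

lemma gnp_expect_superset:
  assumes J: "J \<subseteq> all_pairs n"
  shows "gnp_expect n p (\<lambda>S. of_bool (J \<subseteq> S)) = p ^ card J"
proof -
  let ?A = "all_pairs n"
  have fin: "finite J" using J by (rule finite_subset) simp
  let ?w = "\<lambda>S. p ^ card S * (1 - p) ^ (card ?A - card S)"
  have "gnp_expect n p (\<lambda>S. of_bool (J \<subseteq> S)) = (\<Sum>S\<in>{S \<in> Pow ?A. J \<subseteq> S}. ?w S)"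
    unfolding gnp_expect_def
    by (rule sum.mono_neutral_cong_right) auto
  also have "\<dots> = (\<Sum>T\<in>Pow (?A - J). ?w (J \<union> T))"
    by (rule sum.reindex_bij_witness[where i = "\<lambda>T. J \<union> T" and j = "\<lambda>S. S - J"])
      (use J in \<open>auto simp: Un_absorb1\<close>)
  also have "\<dots> = (\<Sum>T\<in>Pow (?A - J). p ^ card J * (p ^ card T * (1 - p) ^ (card (?A - J) - card T)))"
  proof (rule sum.cong)
    fix T assume T: "T \<in> Pow (?A - J)"
    then have "finite T" by (auto intro: finite_subset[of _ ?A])
    moreover have "J \<inter> T = {}" using T by auto
    ultimately have "card (J \<union> T) = card J + card T" using fin by (simp add: card_Un_disjoint)
    then show "?w (J \<union> T) = p ^ card J * (p ^ card T * (1 - p) ^ (card (?A - J) - card T))"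
      using J fin by (simp add: card_Diff_subset power_add)
  qed simp
  also have "\<dots> = p ^ card J"
    using sum_bernoulli_weights[of "?A - J" p] by (simp flip: sum_distrib_left)
  finally show ?thesis .
qed

lemma gnp_expect_const: "gnp_expect n p (\<lambda>S. c) = c"
  using gnp_expect_superset[of "{}" n p] gnp_expect_cmult[of n p c "\<lambda>_. 1"] by simp

lemma gnp_prob_not: "gnp_prob n p (\<lambda>S. \<not> P S) = 1 - gnp_prob n p P"
proof -
  have "gnp_expect n p (\<lambda>S. of_bool (\<not> P S)) = gnp_expect n p (\<lambda>S. 1 - of_bool (P S))"
    by (rule arg_cong[where f = "gnp_expect n p"]) auto
  then show ?thesis
    by (simp add: gnp_prob_conv_expect gnp_expect_diff gnp_expect_const)
qed

lemma gnp_prob_mono: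
  assumes "0 \<le> p" "p \<le> 1" "\<And>S. S \<subseteq> all_pairs n \<Longrightarrow> P S \<Longrightarrow> Q S"
  shows "gnp_prob n p P \<le> gnp_prob n p Q"
  unfolding gnp_prob_conv_expect using assms by (intro gnp_expect_mono) auto

lemma gnp_prob_le_1: "0 \<le> p \<Longrightarrow> p \<le> 1 \<Longrightarrow> gnp_prob n p P \<le> 1"
  using gnp_expect_mono[of p n "\<lambda>S. of_bool (P S)" "\<lambda>_. 1"]
  by (simp add: gnp_prob_conv_expect gnp_expect_const)

text \<open>Union bound: the indicator of the event is at most the number of sets \<open>T x\<close>
  contained in the random graph.\<close>

lemma gnp_first_moment:
  assumes "0 \<le> p" "p \<le> 1" "finite I" and T: "\<And>x. x \<in> I \<Longrightarrow> T x \<subseteq> all_pairs n"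
  shows "gnp_prob n p (\<lambda>S. \<exists>x\<in>I. T x \<subseteq> S) \<le> (\<Sum>x\<in>I. p ^ card (T x))"
proof -
  have "gnp_prob n p (\<lambda>S. \<exists>x\<in>I. T x \<subseteq> S) \<le> gnp_expect n p (\<lambda>S. \<Sum>x\<in>I. of_bool (T x \<subseteq> S))"
    unfolding gnp_prob_conv_expect
  proof (rule gnp_expect_mono[OF assms(1,2)])
    fix S
    show "of_bool (\<exists>x\<in>I. T x \<subseteq> S) \<le> (\<Sum>x\<in>I. of_bool (T x \<subseteq> S) :: real)"
    proof (cases "\<exists>x\<in>I. T x \<subseteq> S")
      case True
      then obtain x where "x \<in> I" "T x \<subseteq> S" by blast
      then show ?thesis
        using member_le_sum[of x I "\<lambda>x. of_bool (T x \<subseteq> S) :: real"] assms by auto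
    qed (auto intro: sum_nonneg)
  qed
  also have "\<dots> = (\<Sum>x\<in>I. p ^ card (T x))"
    unfolding gnp_expect_sum using T by (intro sum.cong gnp_expect_superset) auto
  finally show ?thesis .
qed

text \<open>Chebyshev's inequality: where no \<open>T x\<close> occurs, the deviation from the mean
  is the mean itself. In the variance, disjoint edge sets are independent and contribute nothing,
  and for the other pairs the subtracted term is dropped.\<close>

lemma gnp_second_moment:
  fixes p :: real
  assumes p: "0 \<le> p" "p \<le> 1" and "finite I"
    and T: "\<And>x. x \<in> I \<Longrightarrow> T x \<subseteq> all_pairs n" "\<And>x. x \<in> I \<Longrightarrow> card (T x) = f"
  shows "gnp_prob n p (\<lambda>S. \<forall>x\<in>I. \<not> T x \<subseteq> S) * (card I * p ^ f) ^ 2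
    \<le> (\<Sum>x\<in>I. \<Sum>y\<in>I. if T x \<inter> T y = {} then 0 else p ^ card (T x \<union> T y))"
proof -
  define \<mu> where "\<mu> = card I * p ^ f"
  define X where "X S = (\<Sum>x\<in>I. of_bool (T x \<subseteq> S) :: real)" for S
  have EX: "gnp_expect n p X = \<mu>"
    unfolding X_def gnp_expect_sum \<mu>_def using gnp_expect_superset T by simp
  have "X S ^ 2 = (\<Sum>x\<in>I. \<Sum>y\<in>I. of_bool (T x \<union> T y \<subseteq> S))" for S
    unfolding X_def power2_eq_square sum_product by (intro sum.cong) auto
  then have EX2: "gnp_expect n p (\<lambda>S. X S ^ 2) = (\<Sum>x\<in>I. \<Sum>y\<in>I. p ^ card (T x \<union> T y))"
    using T by (simp only: gnp_expect_sum) (intro sum.cong refl gnp_expect_superset; simp)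
  have "gnp_prob n p (\<lambda>S. \<forall>x\<in>I. \<not> T x \<subseteq> S) * \<mu> ^ 2
      = gnp_expect n p (\<lambda>S. \<mu> ^ 2 * of_bool (\<forall>x\<in>I. \<not> T x \<subseteq> S))"
    by (simp only: gnp_expect_cmult gnp_prob_conv_expect mult.commute)
  also have "\<dots> \<le> gnp_expect n p (\<lambda>S. (X S - \<mu>) ^ 2)"
    by (rule gnp_expect_mono[OF p]) (auto simp: X_def)
  also have "\<dots> = gnp_expect n p (\<lambda>S. X S ^ 2 - (2 * \<mu>) * X S + \<mu> ^ 2)"
    by (rule arg_cong[where f = "gnp_expect n p"]) (auto simp: power2_eq_square algebra_simps)
  also have "\<dots> = (\<Sum>x\<in>I. \<Sum>y\<in>I. p ^ card (T x \<union> T y)) - \<mu> ^ 2"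
    by (simp only: gnp_expect_add gnp_expect_diff gnp_expect_cmult gnp_expect_const EX EX2)
      (simp add: power2_eq_square)
  also have "(\<Sum>x\<in>I. \<Sum>y\<in>I. p ^ card (T x \<union> T y)) - \<mu> ^ 2 = (\<Sum>x\<in>I. \<Sum>y\<in>I. p ^ card (T x \<union> T y) - p ^ (f + f))"
    by (simp add: sum_subtractf \<mu>_def power2_eq_square power_add)
  also have "\<dots> \<le> (\<Sum>x\<in>I. \<Sum>y\<in>I. if T x \<inter> T y = {} then 0 else p ^ card (T x \<union> T y))"
  proof (intro sum_mono)
    fix x y assume xy: "x \<in> I" "y \<in> I"
    have "finite (T x)" "finite (T y)"
      using finite_subset[OF T(1) finite_all_pairs] xy by blast+
    then have "card (T x \<union> T y) = f + f" if "T x \<inter> T y = {}"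
      using that T xy by (simp add: card_Un_disjoint)
    then show "p ^ card (T x \<union> T y) - p ^ (f + f) \<le> (if T x \<inter> T y = {} then 0 else p ^ card (T x \<union> T y))"
      using p by auto
  qed
  finally show ?thesis by (simp add: \<mu>_def)
qed

section \<open>Prescribed copies in the random graph\<close>

lemma card_PiE_constrained:
  assumes "finite V" "U \<subseteq> V" "D \<subseteq> B"
  shows "card {y \<in> V \<rightarrow>\<^sub>E B. y ` U \<subseteq> D} = card D ^ card U * card B ^ (card V - card U)"
proof -
  have "{y \<in> V \<rightarrow>\<^sub>E B. y ` U \<subseteq> D} = (\<Pi>\<^sub>E v\<in>V. if v \<in> U then D else B)"
    using assms by (force simp: PiE_iff image_subset_iff extensional_def split: if_splits)
  moreover have "card \<dots> = (\<Prod>v\<in>V. if v \<in> U then card D else card B)"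
    using assms by (simp add: card_PiE if_distrib)
  moreover have "\<dots> = card D ^ card (V \<inter> U) * card B ^ card (V - U)"
    using assms by (simp add: prod.If_cases Diff_eq Collect_mem_eq)
  moreover have "V \<inter> U = U" "card (V - U) = card V - card U"
    using assms by (auto simp: card_Diff_subset finite_subset[OF assms(2,1)])
  ultimately show ?thesis by simp
qed

text \<open>A pair of maps \<open>x\<close>, \<open>y\<close> whose images of \<open>F\<close> share the edges indexed by \<open>J\<close> contributes
  \<open>p ^ (2 |F| - |J|)\<close> to the second moment; there are \<open>O(n ^ (2 |V| - |\<Union>J|))\<close> such pairs.\<close>

lemma gnp_contains_copy:
  fixes p \<omega> \<kappa> :: real
  assumes "finite V" and F: "\<And>e. e \<in> F \<Longrightarrow> e \<subseteq> V \<and> card e = 2"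
    and p: "0 < p" "p \<le> 1" and n: "n > 0" and "0 < \<kappa>" "0 < \<omega>"
    and I: "\<And>x. x \<in> I \<Longrightarrow> x \<in> V \<rightarrow>\<^sub>E {..<n} \<and> inj_on x V"
    and many: "\<kappa> * real n ^ card V \<le> real (card I)"
    and sparse: "\<And>J. J \<subseteq> F \<Longrightarrow> J \<noteq> {} \<Longrightarrow> \<omega> \<le> real n ^ card (\<Union>J) * p ^ card J"
  shows "1 - 2 ^ card F * real (card V) ^ card V / (\<kappa> * \<omega>) \<le> gnp_prob n p (\<lambda>S. \<exists>x\<in>I. (`) x ` F \<subseteq> S)"
proof -
  let ?v = "card V" and ?f = "card F"
  define T where "T x = (`) x ` F" for x :: "'a \<Rightarrow> nat"
  have finF: "finite F" using F assms(1) by (intro finite_subset[of F "Pow V"]) auto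
  have finI: "finite I" using I assms(1)
    by (intro finite_subset[of I "V \<rightarrow>\<^sub>E {..<n}"]) (auto intro: finite_PiE)
  have inj: "inj_on ((`) x) F" if "x \<in> I" for x
    using I[OF that] F by (meson inj_on_image_eq_iff inj_onI)
  have T_sub: "T x \<subseteq> all_pairs n" if x: "x \<in> I" for x
  proof
    fix e assume "e \<in> T x"
    then obtain e' where e': "e' \<in> F" "e = x ` e'" by (auto simp: T_def)
    then obtain a b where ab: "e' = {a, b}" "a \<noteq> b" using F[of e'] by (auto simp: card_2_iff)
    then have "a \<in> V" "b \<in> V" using F[OF e'(1)] by auto
    then have "x a < n" "x b < n" "x a \<noteq> x b" using I[OF x] ab by (auto dest: inj_onD)
    then show "e \<in> all_pairs n" using e' ab by (auto simp: all_pairs_def)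
  qed
  have T_card: "card (T x) = ?f" if "x \<in> I" for x
    using inj[OF that] by (simp add: T_def card_image)
  \<comment> \<open>A relaxation that is easy to count: if \<open>y\<close> shares the edges
    \<open>J\<close> with \<open>x\<close>, it maps the vertices covered by \<open>J\<close> into
    the image of \<open>x\<close>.\<close>
  let ?N = "\<lambda>J x. {y \<in> V \<rightarrow>\<^sub>E {..<n}. y ` \<Union>J \<subseteq> x ` V}"
  let ?Js = "Pow F - {{}}"
  have pair: "(if T x \<inter> T y = {} then 0 else p ^ card (T x \<union> T y))
      \<le> (\<Sum>J\<in>?Js. of_bool (y \<in> ?N J x) * p ^ (2 * ?f - card J))" if xy: "x \<in> I" "y \<in> I" for x y
  proof (cases "T x \<inter> T y = {}")
    case True
    then show ?thesis using p by (auto intro!: sum_nonneg)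
  next
    case False
    define J where "J = {e \<in> F. y ` e \<in> T x}"
    have Ty: "T x \<inter> T y = (`) y ` J" by (fastforce simp: J_def T_def)
    have J: "J \<in> ?Js" using False unfolding Ty by (auto simp: J_def)
    have "card (T x \<inter> T y) = card J"
      unfolding Ty using inj[OF xy(2)] by (intro card_image) (auto simp: J_def inj_on_def)
    then have "card (T x \<union> T y) + card J = 2 * ?f"
      using card_Un_Int[of "T x" "T y"] T_card xy finF by (simp add: T_def)
    then have union: "card (T x \<union> T y) = 2 * ?f - card J" by simp
    have "y ` \<Union>J \<subseteq> x ` V"
    proof clarify
      fix e v assume "e \<in> J" "v \<in> e"
      then have "y ` e \<in> T x" by (simp add: J_def)
      then obtain e' where "e' \<in> F" "y ` e = x ` e'" by (auto simp: T_def)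
      then have "y v \<in> x ` e'" using \<open>v \<in> e\<close> by auto
      then show "y v \<in> x ` V" using F[OF \<open>e' \<in> F\<close>] by auto
    qed
    then have "y \<in> ?N J x" using I xy by auto
    then have "p ^ card (T x \<union> T y) = of_bool (y \<in> ?N J x) * p ^ (2 * ?f - card J)"
      using union by simp
    also have "\<dots> \<le> (\<Sum>J\<in>?Js. of_bool (y \<in> ?N J x) * p ^ (2 * ?f - card J))"
      using J finF p by (intro member_le_sum) auto
    finally show ?thesis using False by simp
  qed
  have count: "(\<Sum>y\<in>I. of_bool (y \<in> ?N J x) * p ^ (2 * ?f - card J)) \<le> ?v ^ ?v * real n ^ ?v * (p ^ ?f) ^ 2 / \<omega>"
    if x: "x \<in> I" and J: "J \<in> ?Js" for x J
  proof -
    have UJ: "\<Union>J \<subseteq> V" using J F by blast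
    then have cUJ: "card (\<Union>J) \<le> ?v" using assms(1) by (intro card_mono) auto
    have finN: "finite (?N J x)" using assms(1)
      by (intro finite_subset[of "?N J x" "V \<rightarrow>\<^sub>E {..<n}"]) (auto intro: finite_PiE)
    have cJ: "card J \<le> ?f" using J finF by (auto intro: card_mono)
    have "(\<Sum>y\<in>I. of_bool (y \<in> ?N J x) :: real) = card (I \<inter> ?N J x)"
      using finI by (simp add: sum.If_cases of_bool_def Int_def)
    also have "\<dots> \<le> card (?N J x)" using finN by (intro of_nat_mono card_mono) auto
    also have "\<dots> = real (card (x ` V) ^ card (\<Union>J) * n ^ (?v - card (\<Union>J)))"
      using assms(1) UJ I[OF x] by (subst card_PiE_constrained) auto
    also have "card (x ` V) = ?v" using I[OF x] by (simp add: card_image)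
    also have "real (?v ^ card (\<Union>J) * n ^ (?v - card (\<Union>J))) \<le> real (?v ^ ?v * n ^ (?v - card (\<Union>J)))"
      using cUJ by (intro of_nat_mono mult_le_mono1) (cases "?v = 0"; simp add: power_increasing)
    finally have 1: "(\<Sum>y\<in>I. of_bool (y \<in> ?N J x) :: real) \<le> ?v ^ ?v * real n ^ (?v - card (\<Union>J))" by simp
    have \<omega>: "\<omega> \<le> real n ^ card (\<Union>J) * p ^ card J" using J sparse by auto
    \<comment> \<open>Multiplying by \<open>\<omega>\<close> lets \<open>sparse\<close> restore the
      missing powers of \<open>n\<close> and \<open>p\<close>.\<close>
    have "(?v ^ ?v * real n ^ (?v - card (\<Union>J))) * p ^ (2 * ?f - card J) * \<omega>
        \<le> (?v ^ ?v * real n ^ (?v - card (\<Union>J))) * p ^ (2 * ?f - card J) * (real n ^ card (\<Union>J) * p ^ card J)"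
      using \<omega> p by (intro mult_left_mono) auto
    also have "\<dots> = ?v ^ ?v * (real n ^ (?v - card (\<Union>J)) * real n ^ card (\<Union>J)) * (p ^ (2 * ?f - card J) * p ^ card J)"
      by (simp add: mult_ac)
    also have "\<dots> = ?v ^ ?v * real n ^ ?v * (p ^ ?f) ^ 2"
      using cUJ cJ by (simp flip: power_add power_mult add: mult.commute)
    finally have 2: "(?v ^ ?v * real n ^ (?v - card (\<Union>J))) * p ^ (2 * ?f - card J) \<le> ?v ^ ?v * real n ^ ?v * (p ^ ?f) ^ 2 / \<omega>"
      using \<open>0 < \<omega>\<close> by (simp add: pos_le_divide_eq)
    have "(\<Sum>y\<in>I. of_bool (y \<in> ?N J x) * p ^ (2 * ?f - card J))
        = (\<Sum>y\<in>I. of_bool (y \<in> ?N J x)) * p ^ (2 * ?f - card J)"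
      by (rule sum_distrib_right[symmetric])
    also have "\<dots> \<le> (?v ^ ?v * real n ^ (?v - card (\<Union>J))) * p ^ (2 * ?f - card J)"
      using 1 p by (intro mult_right_mono) auto
    finally show ?thesis using 2 by linarith
  qed
  define B where "B = ?v ^ ?v * real n ^ ?v * (p ^ ?f) ^ 2 / \<omega>"
  have B: "B \<ge> 0" using p assms by (simp add: B_def)
  let ?P = "gnp_prob n p (\<lambda>S. \<forall>x\<in>I. \<not> T x \<subseteq> S)"
  have "?P * (card I * p ^ ?f) ^ 2 \<le> (\<Sum>x\<in>I. \<Sum>y\<in>I. if T x \<inter> T y = {} then 0 else p ^ card (T x \<union> T y))"
    using p finI T_sub T_card by (intro gnp_second_moment) auto
  also have "\<dots> \<le> (\<Sum>x\<in>I. \<Sum>y\<in>I. \<Sum>J\<in>?Js. of_bool (y \<in> ?N J x) * p ^ (2 * ?f - card J))"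
    by (intro sum_mono pair)
  also have "\<dots> = (\<Sum>x\<in>I. \<Sum>J\<in>?Js. \<Sum>y\<in>I. of_bool (y \<in> ?N J x) * p ^ (2 * ?f - card J))"
    by (intro sum.cong refl sum.swap)
  also have "\<dots> \<le> (\<Sum>x\<in>I. \<Sum>J\<in>?Js. B)"
    unfolding B_def by (intro sum_mono count)
  also have "\<dots> = card I * (card ?Js * B)" by simp
  also have "\<dots> \<le> card I * (2 ^ ?f * B)"
  proof -
    have "card ?Js \<le> 2 ^ ?f" using finF card_mono[of "Pow F" ?Js] by (simp add: card_Pow)
    then have "real (card ?Js) \<le> 2 ^ ?f" by (metis of_nat_le_iff of_nat_numeral of_nat_power)
    then show ?thesis using B by (intro mult_left_mono mult_right_mono) auto
  qed
  finally have main: "?P * (card I * p ^ ?f) ^ 2 \<le> card I * (2 ^ ?f * B)" .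
  have "0 < \<kappa> * real n ^ ?v" using assms by simp
  then have I_pos: "0 < real (card I)" using many by linarith
  \<comment> \<open>The factor \<open>card I * (p ^ ?f) ^ 2\<close> cancels; the remaining
    \<open>card I\<close> is bounded below by \<open>many\<close>.\<close>
  have "?P * card I * (card I * (p ^ ?f) ^ 2) \<le> 2 ^ ?f * (?v ^ ?v * real n ^ ?v / \<omega>) * (card I * (p ^ ?f) ^ 2)"
    using main by (simp add: B_def power2_eq_square mult_ac)
  then have "?P * card I \<le> 2 ^ ?f * (?v ^ ?v * real n ^ ?v / \<omega>)"
    by (rule mult_right_le_imp_le) (use I_pos p in simp)
  then have "?P \<le> 2 ^ ?f * (?v ^ ?v * real n ^ ?v / \<omega>) / card I"
    using I_pos by (simp only: pos_le_divide_eq)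
  also have "\<dots> \<le> 2 ^ ?f * (?v ^ ?v * real n ^ ?v / \<omega>) / (\<kappa> * real n ^ ?v)"
    using many \<open>0 < \<kappa> * real n ^ ?v\<close> \<open>0 < \<omega>\<close> I_pos by (intro divide_left_mono) auto
  also have "\<dots> = 2 ^ ?f * ?v ^ ?v / (\<kappa> * \<omega>)" using n by (simp add: field_simps)
  finally have "?P \<le> 2 ^ ?f * ?v ^ ?v / (\<kappa> * \<omega>)" .
  moreover have "(\<lambda>S. \<exists>x\<in>I. T x \<subseteq> S) = (\<lambda>S. \<not> (\<forall>x\<in>I. \<not> T x \<subseteq> S))" by auto
  ultimately show ?thesis unfolding T_def[symmetric] by (simp only: gnp_prob_not) simp
qed

text \<open>First moment over the at most \<open>n ^ m\<close> labelled cycles, each of which has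
  \<open>m\<close> distinct edges.\<close>

lemma gnp_has_cycle_le:
  assumes p: "0 \<le> p" "p \<le> 1" and m: "m \<ge> 3"
  shows "gnp_prob n p (has_cycle m) \<le> (real n * p) ^ m"
proof -
  let ?s = "\<lambda>i. (i + 1) mod m"
  define I where "I = {f \<in> {..<m} \<rightarrow>\<^sub>E {..<n}. inj_on f {..<m}}"
  define T where "T f = (\<lambda>i. {f i, f (?s i)}) ` {..<m}" for f :: "nat \<Rightarrow> nat"
  have finI: "finite I" unfolding I_def
    by (rule finite_subset[of _ "{..<m} \<rightarrow>\<^sub>E {..<n}"]) (auto intro: finite_PiE)
  \<comment> \<open>The third property rules out that an edge is traversed in both directions, which
    is what happens for \<open>m = 2\<close>.\<close>
  have s: "?s i < m" "?s i \<noteq> i" "?s (?s i) \<noteq> i" if "i < m" for i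
    using that m by (auto simp: mod_Suc split: if_splits)
  have T: "T f \<subseteq> all_pairs n" "card (T f) = m" if f: "f \<in> I" for f
  proof -
    have inj: "f i = f j \<longleftrightarrow> i = j" if "i < m" "j < m" for i j
      using f that by (auto simp: I_def inj_on_def)
    show "T f \<subseteq> all_pairs n"
    proof
      fix e assume "e \<in> T f"
      then obtain i where i: "i < m" "e = {f i, f (?s i)}" by (auto simp: T_def)
      have "f i < n" "f (?s i) < n" using f i(1) s(1)[OF i(1)] by (auto simp: I_def PiE_iff)
      moreover have "f i \<noteq> f (?s i)" using inj[OF i(1) s(1)] s(2)[OF i(1)] i(1) by auto
      ultimately show "e \<in> all_pairs n" using i by (auto simp: all_pairs_def)
    qed
    have "inj_on (\<lambda>i. {f i, f (?s i)}) {..<m}"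
    proof (rule inj_onI)
      fix i j assume ij: "i \<in> {..<m}" "j \<in> {..<m}" and eq: "{f i, f (?s i)} = {f j, f (?s j)}"
      from eq have "f i = f j \<or> f i = f (?s j) \<and> f (?s i) = f j" unfolding doubleton_eq_iff by blast
      then have "i = j \<or> i = ?s j \<and> ?s i = j"
        using inj[of i j] inj[of i "?s j"] inj[of "?s i" j] ij s(1) by (simp only: lessThan_iff)
      then show "i = j" using s(3)[of i] ij by auto
    qed
    then show "card (T f) = m" by (simp add: T_def card_image)
  qed
  have "gnp_prob n p (has_cycle m) \<le> gnp_prob n p (\<lambda>S. \<exists>f\<in>I. T f \<subseteq> S)"
  proof (rule gnp_prob_mono[OF p])
    fix S assume S: "S \<subseteq> all_pairs n" "has_cycle m S"
    then obtain f where f: "inj_on f {..<m}" "\<And>i. i < m \<Longrightarrow> {f i, f (?s i)} \<in> S"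
      unfolding has_cycle_def by blast
    have "f i < n" if "i < m" for i using f(2)[OF that] S by (auto simp: all_pairs_def doubleton_eq_iff)
    then have "restrict f {..<m} \<in> I" using f by (auto simp: I_def inj_on_def)
    moreover have "T (restrict f {..<m}) \<subseteq> S" using f s unfolding T_def by auto
    ultimately show "\<exists>f\<in>I. T f \<subseteq> S" by blast
  qed
  also have "\<dots> \<le> (\<Sum>f\<in>I. p ^ card (T f))" using p finI T by (intro gnp_first_moment) auto
  also have "\<dots> = card I * p ^ m" using T by simp
  also have "\<dots> \<le> real (n ^ m) * p ^ m"
  proof -
    have "card I \<le> card ({..<m} \<rightarrow>\<^sub>E {..<n})" unfolding I_def by (intro card_mono finite_PiE) auto
    then have "card I \<le> n ^ m" by (simp add: card_funcsetE)
    then show ?thesis using p by (intro mult_right_mono of_nat_mono) auto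
  qed
  finally show ?thesis by (simp add: power_mult_distrib)
qed

lemma gnp_nonempty_le:
  assumes p: "0 \<le> p" "p \<le> 1"
  shows "gnp_prob n p (\<lambda>S. S \<noteq> {}) \<le> real n ^ 2 * p"
proof -
  have "gnp_prob n p (\<lambda>S. S \<noteq> {}) \<le> gnp_prob n p (\<lambda>S. \<exists>e\<in>all_pairs n. {e} \<subseteq> S)"
    by (rule gnp_prob_mono[OF p]) auto
  also have "\<dots> \<le> (\<Sum>e\<in>all_pairs n. p ^ card {e})" using p by (intro gnp_first_moment) auto
  also have "\<dots> = card (all_pairs n) * p" by simp
  also have "\<dots> \<le> real (n ^ 2) * p"
  proof -
    have "all_pairs n \<subseteq> (\<lambda>(x, y). {x, y}) ` ({..<n} \<times> {..<n})" by (auto simp: all_pairs_def)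
    then have "card (all_pairs n) \<le> card ({..<n} \<times> {..<n})"
      by (meson card_image_le card_mono finite_SigmaI finite_imageI finite_lessThan le_trans)
    then have "card (all_pairs n) \<le> n ^ 2" by (simp add: power2_eq_square)
    then show ?thesis using p by (intro mult_right_mono of_nat_mono) auto
  qed
  finally show ?thesis by simp
qed

section \<open>Non-Ramsey graphs\<close>

lemma no_odd_cycle_bipartite:
  assumes "odd m" and h: "\<And>x y. {x, y} \<in> E \<Longrightarrow> h x \<longleftrightarrow> \<not> h y"
  shows "\<not> has_cycle m E"
proof
  assume "has_cycle m E"
  then obtain f where f: "\<And>i. i < m \<Longrightarrow> {f i, f ((i + 1) mod m)} \<in> E" unfolding has_cycle_def by blast
  show False
    by (rule no_alternating_odd_cycle[OF \<open>odd m\<close>, of "\<lambda>i. h (f i)"]) (use h[OF f] in blast)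
qed

text \<open>Edges are unordered, so a colouring given by a predicate on ordered pairs has to be
  symmetric; both colour classes can then be studied through pairs \<open>{x, y}\<close>
  alone.\<close>

lemma not_cycle_ramsey_colouring:
  assumes sym: "\<And>x y. \<chi> x y \<longleftrightarrow> \<chi> y x"
    and "\<And>R. (\<And>x y. {x, y} \<in> R \<Longrightarrow> {x, y} \<in> E \<and> \<chi> x y) \<Longrightarrow> \<not> has_cycle k R"
    and "\<And>R. (\<And>x y. {x, y} \<in> R \<Longrightarrow> {x, y} \<in> E \<and> \<not> \<chi> x y) \<Longrightarrow> \<not> has_cycle l R"
  shows "\<not> cycle_ramsey k l E"
proof -
  define R where "R = {e \<in> E. \<exists>x y. e = {x, y} \<and> \<chi> x y}"
  have R: "{x, y} \<in> R \<longleftrightarrow> {x, y} \<in> E \<and> \<chi> x y" for x y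
    using sym by (auto simp: R_def doubleton_eq_iff)
  have "\<not> has_cycle k R" by (rule assms(2)) (simp add: R)
  moreover have "\<not> has_cycle l (E - R)" by (rule assms(3)) (auto simp: R)
  moreover have "R \<subseteq> E" by (auto simp: R_def)
  ultimately show ?thesis unfolding cycle_ramsey_def by blast
qed

section \<open>Turan graphs and their colourings\<close>

definition turan_graph :: "nat \<Rightarrow> nat \<Rightarrow> nat set set" where
  "turan_graph r n = {e. \<exists>x y. x < n \<and> y < n \<and> x mod r \<noteq> y mod r \<and> e = {x, y}}"

lemma turan_graph_iff: "{x, y} \<in> turan_graph r n \<longleftrightarrow> x < n \<and> y < n \<and> x mod r \<noteq> y mod r"
  by (auto simp: turan_graph_def doubleton_eq_iff)

lemma graph_on_turan: "graph_on n (turan_graph r n)"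
  unfolding graph_on_def all_pairs_def turan_graph_def by auto

lemma card_all_pairs: "card (all_pairs n) = n choose 2"
proof -
  have "all_pairs n = {e. e \<subseteq> {..<n} \<and> card e = 2}"
    by (auto simp: all_pairs_def card_2_iff)
  then show ?thesis by (simp add: n_subsets)
qed

text \<open>For each \<open>y\<close> there are \<open>y div r\<close> smaller vertices in the class of \<open>y\<close>, so the number of
  missing edges is at most \<open>\<Sum>y<n. y / r\<close>.\<close>

lemma density_turan:
  assumes "r > 0" "n \<ge> 2"
  shows "1 - 1 / r \<le> density n (turan_graph r n)"
proof -
  let ?M = "SIGMA y:{..<n}. {x. x < y \<and> x mod r = y mod r}"
  have "all_pairs n - turan_graph r n \<subseteq> (\<lambda>(y, x). {x, y}) ` ?M"
  proof
    fix e assume e: "e \<in> all_pairs n - turan_graph r n"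
    then obtain x y where xy: "x < n" "y < n" "x \<noteq> y" "e = {x, y}" by (auto simp: all_pairs_def)
    then have m: "x mod r = y mod r" using e by (auto simp: turan_graph_def)
    show "e \<in> (\<lambda>(y, x). {x, y}) ` ?M"
    proof (cases "x < y")
      case True
      with xy m show ?thesis by (intro image_eqI[of _ _ "(y, x)"]) auto
    next
      case False
      with xy m show ?thesis by (intro image_eqI[of _ _ "(x, y)"]) auto
    qed
  qed
  moreover have finM: "finite ?M" by simp
  ultimately have "card (all_pairs n - turan_graph r n) \<le> card ((\<lambda>(y, x). {x, y}) ` ?M)"
    by (intro card_mono) auto
  also have "\<dots> \<le> card ?M" using finM by (rule card_image_le)
  also have "\<dots> = (\<Sum>y<n. card {x. x < y \<and> x mod r = y mod r})" by simp
  also have "\<dots> \<le> (\<Sum>y<n. y div r)"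
  proof (rule sum_mono)
    fix y
    have "inj_on (\<lambda>x. x div r) {x. x < y \<and> x mod r = y mod r}"
    proof (rule inj_onI)
      fix x x' assume "x \<in> {x. x < y \<and> x mod r = y mod r}" "x' \<in> {x. x < y \<and> x mod r = y mod r}" "x div r = x' div r"
      then show "x = x'" using div_mult_mod_eq[of x r] div_mult_mod_eq[of x' r] by simp
    qed
    moreover have "x div r < y div r" if "x < y" "x mod r = y mod r" for x
    proof (rule ccontr)
      assume "\<not> x div r < y div r"
      then have "y div r * r \<le> x div r * r" by simp
      then have "y \<le> x" using that(2) by (metis add_le_cancel_right div_mult_mod_eq)
      with that show False by simp
    qed
    then have "(\<lambda>x. x div r) ` {x. x < y \<and> x mod r = y mod r} \<subseteq> {..<y div r}" by auto
    ultimately have "card {x. x < y \<and> x mod r = y mod r} \<le> card {..<y div r}"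
      by (rule card_inj_on_le) simp
    then show "card {x. x < y \<and> x mod r = y mod r} \<le> y div r" by simp
  qed
  finally have "real (card (all_pairs n - turan_graph r n)) \<le> (\<Sum>y<n. real (y div r))"
    by (metis of_nat_le_iff of_nat_sum)
  also have "\<dots> \<le> (\<Sum>y<n. real y / r)"
    by (intro sum_mono) (simp add: of_nat_div_le_of_nat)
  also have "\<dots> = (n choose 2) / r"
    using Sum_Ico_nat[of 0 n] real_choose_2[of n]
    by (simp flip: sum_divide_distrib of_nat_sum add: gauss_sum choose_two atLeast0LessThan)
  finally have miss: "real (card (all_pairs n - turan_graph r n)) \<le> (n choose 2) / r" .
  have sub: "turan_graph r n \<subseteq> all_pairs n" using graph_on_turan by (simp add: graph_on_def)
  then have "real (card (all_pairs n - turan_graph r n)) = real (n choose 2) - card (turan_graph r n)"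
    using card_mono[OF _ sub] finite_subset[OF sub]
    by (simp add: card_Diff_subset card_all_pairs[symmetric] of_nat_diff)
  with miss have "(1 - 1 / r) * (n choose 2) \<le> card (turan_graph r n)"
    by (simp add: left_diff_distrib)
  moreover have "0 < real (n choose 2)" using assms by simp
  ultimately show ?thesis by (simp add: density_def pos_le_divide_eq)
qed

lemma dense_seq_turan: "r > 0 \<Longrightarrow> d \<le> 1 - 1 / r \<Longrightarrow> dense_seq d (turan_graph r)"
  unfolding dense_seq_def using graph_on_turan density_turan order_trans by blast

lemma turan_2_bipartite:
  assumes "odd m"
  shows "\<not> has_cycle m (turan_graph 2 n)"
proof (rule no_odd_cycle_bipartite[OF assms, of _ even])
  fix x y assume "{x, y} \<in> turan_graph 2 n"
  then have "x mod 2 \<noteq> y mod 2" by (simp add: turan_graph_iff)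
  then show "even x \<longleftrightarrow> \<not> even y" by presburger
qed

text \<open>Red joins the residues 0, 1 to the residues 2, 3; the remaining edges, 0 to 1 and 2 to
  3, change parity. Both colours are bipartite.\<close>

lemma turan_4_not_ramsey: "odd k \<Longrightarrow> odd l \<Longrightarrow> \<not> cycle_ramsey k l (turan_graph 4 n)"
proof (rule not_cycle_ramsey_colouring[where \<chi> = "\<lambda>x y. x mod 4 < 2 \<longleftrightarrow> \<not> y mod 4 < 2"])
  fix R assume "odd k" and "\<And>x y. {x, y} \<in> R \<Longrightarrow> {x, y} \<in> turan_graph 4 n \<and> (x mod 4 < 2 \<longleftrightarrow> \<not> y mod 4 < 2)"
  then show "\<not> has_cycle k R" by (intro no_odd_cycle_bipartite[of k _ "\<lambda>x. x mod 4 < 2"]) blast+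
next
  fix R assume l: "odd l" and R: "\<And>x y. {x, y} \<in> R \<Longrightarrow> {x, y} \<in> turan_graph 4 n \<and> \<not> (x mod 4 < 2 \<longleftrightarrow> \<not> y mod 4 < 2)"
  show "\<not> has_cycle l R"
  proof (rule no_odd_cycle_bipartite[OF l, of _ even])
    fix x y assume "{x, y} \<in> R"
    then have "x mod 4 \<noteq> y mod 4" "(x mod 4 < 2) = (y mod 4 < 2)"
      using R[of x y] by (auto simp: turan_graph_iff)
    moreover have "even (x mod 4) \<longleftrightarrow> even x" "even (y mod 4) \<longleftrightarrow> even y"
      by (simp_all add: dvd_mod_iff)
    moreover have "even a \<noteq> even b" if "a < 4" "b < 4" "a \<noteq> b" "(a < 2) = (b < 2)" for a b :: nat
      using that by presburger
    from this[of "x mod 4" "y mod 4"] calculation(1,2) have "even (x mod 4) \<noteq> even (y mod 4)" by simp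
    ultimately show "even x \<longleftrightarrow> \<not> even y" by simp
  qed
qed auto

text \<open>Red joins residues at distance 1 modulo 5, blue those at distance 2. Both are blow-ups
  of a pentagon, hence triangle-free.\<close>

lemma turan_5_not_ramsey: "\<not> cycle_ramsey 3 3 (turan_graph 5 n)"
proof (rule not_cycle_ramsey_colouring[where
      \<chi> = "\<lambda>x y. y mod 5 = (x mod 5 + 1) mod 5 \<or> x mod 5 = (y mod 5 + 1) mod 5"])
  have triangle: "\<exists>x y z. {x, y} \<in> R \<and> {y, z} \<in> R \<and> {z, x} \<in> R" if cyc: "has_cycle 3 R" for R
  proof -
    obtain f :: "nat \<Rightarrow> nat" where f: "\<forall>i<3. {f i, f ((i + 1) mod 3)} \<in> R"
      using cyc unfolding has_cycle_def by blast
    from f[rule_format, of 0] f[rule_format, of 1] f[rule_format, of 2]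
    show ?thesis by (auto simp: numeral_2_eq_2)
  qed
  have five: "x mod 5 \<in> {0, 1, 2, 3, 4}" for x :: nat
    by (simp, presburger)
  show "\<not> has_cycle 3 R"
    if "\<And>x y. {x, y} \<in> R \<Longrightarrow> {x, y} \<in> turan_graph 5 n \<and>
      (y mod 5 = (x mod 5 + 1) mod 5 \<or> x mod 5 = (y mod 5 + 1) mod 5)" for R
  proof
    assume "has_cycle 3 R"
    then obtain x y z where xyz: "{x, y} \<in> R" "{y, z} \<in> R" "{z, x} \<in> R" using triangle by blast
    have f: "x mod 5 \<in> {0, 1, 2, 3, 4}" "y mod 5 \<in> {0, 1, 2, 3, 4}" "z mod 5 \<in> {0, 1, 2, 3, 4}" by (fact five)+
    show False using f that[OF xyz(1)] that[OF xyz(2)] that[OF xyz(3)]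
      unfolding turan_graph_iff by (elim insertE emptyE; simp)
  qed
  show "\<not> has_cycle 3 R"
    if "\<And>x y. {x, y} \<in> R \<Longrightarrow> {x, y} \<in> turan_graph 5 n \<and>
      \<not> (y mod 5 = (x mod 5 + 1) mod 5 \<or> x mod 5 = (y mod 5 + 1) mod 5)" for R
  proof
    assume "has_cycle 3 R"
    then obtain x y z where xyz: "{x, y} \<in> R" "{y, z} \<in> R" "{z, x} \<in> R" using triangle by blast
    have f: "x mod 5 \<in> {0, 1, 2, 3, 4}" "y mod 5 \<in> {0, 1, 2, 3, 4}" "z mod 5 \<in> {0, 1, 2, 3, 4}" by (fact five)+
    show False using f that[OF xyz(1)] that[OF xyz(2)] that[OF xyz(3)]
      unfolding turan_graph_iff by (elim insertE emptyE; simp)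
  qed
qed auto

section \<open>Lower bounds for the thresholds\<close>

lemma gnp_prob_tendsto_1:
  assumes p: "prob_seq p" and "f \<longlonglongrightarrow> 0"
    and "eventually (\<lambda>n. 1 - f n \<le> gnp_prob n (p n) (P n)) sequentially"
  shows "(\<lambda>n. gnp_prob n (p n) (P n)) \<longlonglongrightarrow> 1"
proof (rule tendsto_sandwich[of "\<lambda>n. 1 - f n" _ _ "\<lambda>_. 1"])
  show "(\<lambda>n. 1 - f n) \<longlonglongrightarrow> 1" using tendsto_diff[OF tendsto_const assms(2), of 1] by simp
  show "eventually (\<lambda>n. gnp_prob n (p n) (P n) \<le> 1) sequentially"
    using p by (simp add: prob_seq_def gnp_prob_le_1)
qed (use assms in auto)

text \<open>One colour for the random edges, the other for the rest of the bipartite graph. For odd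
  \<open>l\<close> the random edges are red and must avoid length \<open>k\<close>; for even
  \<open>l\<close> the dense edges are red and the random ones must avoid length \<open>l\<close>.
  This explains the choice of \<open>m\<close>.\<close>

lemma lower_threshold_bipartite:
  assumes p: "prob_seq p" "(\<lambda>n. p n / (1 / real n)) \<longlonglongrightarrow> 0" and "odd k" "3 \<le> k" "3 \<le> l"
  shows "(\<lambda>n. gnp_prob n (p n) (\<lambda>S. \<not> cycle_ramsey k l (turan_graph 2 n \<union> S))) \<longlonglongrightarrow> 1"
proof -
  define m where "m = (if odd l then k else l)"
  have m: "3 \<le> m" using assms by (simp add: m_def)
  show ?thesis
  proof (rule gnp_prob_tendsto_1[OF p(1)])
    have "(\<lambda>n. real n * p n) \<longlonglongrightarrow> 0" using p(2) by (simp add: mult.commute)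
    from tendsto_power[OF this, of m] show "(\<lambda>n. (real n * p n) ^ m) \<longlonglongrightarrow> 0"
      using m by (simp only: power_0_left) simp
    have "1 - (real n * p n) ^ m \<le> gnp_prob n (p n) (\<lambda>S. \<not> cycle_ramsey k l (turan_graph 2 n \<union> S))" for n
    proof -
      have pn: "0 \<le> p n" "p n \<le> 1" using p by (auto simp: prob_seq_def)
      have "1 - (real n * p n) ^ m \<le> gnp_prob n (p n) (\<lambda>S. \<not> has_cycle m S)"
        using gnp_has_cycle_le[OF pn m] by (simp add: gnp_prob_not)
      also have "\<dots> \<le> gnp_prob n (p n) (\<lambda>S. \<not> cycle_ramsey k l (turan_graph 2 n \<union> S))"
      proof (rule gnp_prob_mono[OF pn])
        fix S assume S: "\<not> has_cycle m S"
        let ?G = "turan_graph 2 n"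
        show "\<not> cycle_ramsey k l (?G \<union> S)"
        proof (cases "odd l")
          case True
          then have "\<not> has_cycle k S" using S by (simp add: m_def)
          moreover have "\<not> has_cycle l (?G \<union> S - S)"
            using turan_2_bipartite[OF True] has_cycle_mono[of l "?G \<union> S - S" ?G] by blast
          ultimately show ?thesis unfolding cycle_ramsey_def by blast
        next
          case False
          then have "\<not> has_cycle l (?G \<union> S - ?G)"
            using S has_cycle_mono[of l "?G \<union> S - ?G" S] by (auto simp: m_def)
          moreover have "\<not> has_cycle k ?G" using turan_2_bipartite \<open>odd k\<close> .
          ultimately show ?thesis unfolding cycle_ramsey_def by blast
        qed
      qed
      finally show ?thesis .
    qed
    then show "eventually (\<lambda>n. 1 - (real n * p n) ^ m
        \<le> gnp_prob n (p n) (\<lambda>S. \<not> cycle_ramsey k l (turan_graph 2 n \<union> S))) sequentially" by simp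
  qed
qed

text \<open>With high probability the random graph is empty and leaves \<open>G n\<close>
  unchanged.\<close>

lemma lower_threshold_empty:
  assumes p: "prob_seq p" "(\<lambda>n. p n / (1 / real n ^ 2)) \<longlonglongrightarrow> 0"
    and G: "\<And>n. \<not> cycle_ramsey k l (G n)"
  shows "(\<lambda>n. gnp_prob n (p n) (\<lambda>S. \<not> cycle_ramsey k l (G n \<union> S))) \<longlonglongrightarrow> 1"
proof (rule gnp_prob_tendsto_1[OF p(1)])
  show "(\<lambda>n. real n ^ 2 * p n) \<longlonglongrightarrow> 0" using p(2) by (simp add: mult.commute)
  have "1 - real n ^ 2 * p n \<le> gnp_prob n (p n) (\<lambda>S. \<not> cycle_ramsey k l (G n \<union> S))" for n
  proof -
    have pn: "0 \<le> p n" "p n \<le> 1" using p by (auto simp: prob_seq_def)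
    have "1 - real n ^ 2 * p n \<le> gnp_prob n (p n) (\<lambda>S. \<not> S \<noteq> {})"
      using gnp_nonempty_le[OF pn, of n] unfolding gnp_prob_not by simp
    also have "\<dots> \<le> gnp_prob n (p n) (\<lambda>S. \<not> cycle_ramsey k l (G n \<union> S))"
      by (rule gnp_prob_mono[OF pn]) (use G in auto)
    finally show ?thesis .
  qed
  then show "eventually (\<lambda>n. 1 - real n ^ 2 * p n
      \<le> gnp_prob n (p n) (\<lambda>S. \<not> cycle_ramsey k l (G n \<union> S))) sequentially" by simp
qed

section \<open>Thresholds\<close>

text \<open>Parts are numbered from \<open>0\<close> to \<open>s\<close>, which matches the Turan
  density \<open>1 - 1 / s\<close> for \<open>s + 1\<close> parts. Supersaturation is used only for
  the existence of one injective copy of the blow-up.\<close>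

lemma threshold_zero_of_forces:
  assumes "forces q part {} k l" "\<And>c. c < q \<Longrightarrow> part c \<le> s" "1 \<le> s" "1 - 1 / real s < d"
  shows "threshold_zero k l d"
proof -
  obtain M where M: "\<And>\<phi> E. blowup q part {} M \<phi> E \<Longrightarrow> cycle_ramsey k l E"
    using ramsey_blowup[OF assms(1), of "Suc s"] assms(2) by (auto simp: less_Suc_eq_le)
  let ?V = "{..<q} \<times> {..<M}" and ?part = "\<lambda>v. part (fst v)"
  have "finite ?V" "?part ` ?V \<subseteq> {..s}" using assms(2) by auto
  from supersaturation[OF assms(3,4) this]
  obtain \<kappa> N where \<kappa>: "\<kappa> > 0" and N: "\<forall>n\<ge>N. \<forall>E. graph_on n E \<and> d \<le> density n E \<longrightarrow>
      \<kappa> * real n ^ card ?V \<le> real (card {x \<in> homs {..<n} E ?part ?V. inj_on x ?V})"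
    by blast
  show ?thesis
    unfolding threshold_zero_def
  proof (intro exI[of _ "max N 1"] allI impI; elim conjE)
    fix n E assume n: "max N 1 \<le> n" and E: "graph_on n E" "d \<le> density n E"
    have "0 < \<kappa> * real n ^ card ?V" using \<kappa> n by simp
    then have "0 < card {x \<in> homs {..<n} E ?part ?V. inj_on x ?V}" using N[rule_format, OF _ conjI[OF E]] n by linarith
    then have "{x \<in> homs {..<n} E ?part ?V. inj_on x ?V} \<noteq> {}" by (rule card_gt_0_iff[THEN iffD1, THEN conjunct1])
    then obtain x where x: "x \<in> homs {..<n} E ?part ?V" "inj_on x ?V" by blast
    then have "blowup q part {} M x E" by (auto simp: blowup_def homs_def)
    then show "cycle_ramsey k l E" by (rule M)
  qed
qed

definition link_edges :: "(nat \<times> nat) set \<Rightarrow> nat \<Rightarrow> (nat \<times> nat) set set" where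
  "link_edges L M = {{(c, j), (d, j)} | c d j. (c, d) \<in> L \<and> j < M}"

text \<open>With \<open>a\<close> chosen such that every set of links covers at least \<open>a\<close> times as many vertices as it has
  edges, the random graph supplies the links as soon as \<open>n ^ a * p\<close> tends to infinity.\<close>

lemma upper_threshold_of_forces:
  assumes "forces q part L k l" "\<And>c. c < q \<Longrightarrow> part c \<le> s" "1 \<le> s" "1 - 1 / real s < d"
    and L: "\<And>c e. (c, e) \<in> L \<Longrightarrow> c < q \<and> e < q \<and> c \<noteq> e"
    and sparse: "\<And>M J. J \<subseteq> link_edges L M \<Longrightarrow> a * card J \<le> card (\<Union>J)"
    and p: "prob_seq p" "filterlim (\<lambda>n. p n / (1 / real n ^ a)) at_top sequentially"
    and G: "dense_seq d G"
  shows "(\<lambda>n. gnp_prob n (p n) (\<lambda>S. cycle_ramsey k l (G n \<union> S))) \<longlonglongrightarrow> 1"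
proof -
  obtain M where M: "\<And>\<phi> E. blowup q part L M \<phi> E \<Longrightarrow> cycle_ramsey k l E"
    using ramsey_blowup[OF assms(1), of "Suc s"] assms(2) by (auto simp: less_Suc_eq_le)
  let ?V = "{..<q} \<times> {..<M}" and ?part = "\<lambda>v. part (fst v)"
  let ?F = "link_edges L M"
  have "finite ?V" "?part ` ?V \<subseteq> {..s}" using assms(2) by auto
  from supersaturation[OF assms(3,4) this]
  obtain \<kappa> N where \<kappa>: "\<kappa> > 0" and N: "\<forall>n\<ge>N. \<forall>E. graph_on n E \<and> d \<le> density n E \<longrightarrow>
      \<kappa> * real n ^ card ?V \<le> real (card {x \<in> homs {..<n} E ?part ?V. inj_on x ?V})"
    by blast
  have F: "e \<subseteq> ?V \<and> card e = 2" if "e \<in> ?F" for e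
    using that L by (auto simp: link_edges_def)
  define \<omega> where "\<omega> n = p n * real n ^ a" for n
  have \<omega>: "filterlim \<omega> at_top sequentially" using p(2) by (simp add: \<omega>_def[abs_def])
  define K where "K = 2 ^ card ?F * real (card ?V) ^ card ?V / \<kappa>"
  show ?thesis
  proof (rule gnp_prob_tendsto_1[OF p(1), of "\<lambda>n. K / \<omega> n"])
    show "(\<lambda>n. K / \<omega> n) \<longlonglongrightarrow> 0"
      by (rule real_tendsto_divide_at_top[OF tendsto_const \<omega>])
    have "eventually (\<lambda>n. 1 \<le> \<omega> n) sequentially" using \<omega> by (simp add: filterlim_at_top)
    moreover have "eventually (\<lambda>n. max N 2 \<le> n) sequentially" by (rule eventually_ge_at_top)
    ultimately show "eventually (\<lambda>n. 1 - K / \<omega> n \<le> gnp_prob n (p n) (\<lambda>S. cycle_ramsey k l (G n \<union> S))) sequentially"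
    proof eventually_elim
      case (elim n)
      have pn: "0 \<le> p n" "p n \<le> 1" using p by (auto simp: prob_seq_def)
      have "p n \<noteq> 0" using elim by (auto simp: \<omega>_def)
      then have pn0: "0 < p n" using pn by simp
      let ?I = "{x \<in> homs {..<n} (G n) ?part ?V. inj_on x ?V}"
      have "graph_on n (G n)" "d \<le> density n (G n)" using G elim by (auto simp: dense_seq_def)
      then have many: "\<kappa> * real n ^ card ?V \<le> real (card ?I)" using N[rule_format, of n "G n"] elim by simp
      have "1 - 2 ^ card ?F * real (card ?V) ^ card ?V / (\<kappa> * \<omega> n)
          \<le> gnp_prob n (p n) (\<lambda>S. \<exists>x\<in>?I. (`) x ` ?F \<subseteq> S)"
      proof (rule gnp_contains_copy)
        fix J assume J: "J \<subseteq> ?F" "J \<noteq> {}"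
        have "finite ?F" using F by (intro finite_subset[of ?F "Pow ?V"]) auto
        then have "1 \<le> card J" using J by (metis One_nat_def Suc_leI card_gt_0_iff finite_subset)
        \<comment> \<open>As \<open>\<omega> n\<close> is at least 1, the bound for a single edge
          passes to all nonempty \<open>J\<close>; the ratio hypothesis then exchanges edges for
          covered vertices.\<close>
        then have "\<omega> n \<le> \<omega> n ^ card J" using elim power_increasing[of 1 "card J" "\<omega> n"] by simp
        also have "\<dots> = real n ^ (a * card J) * p n ^ card J"
          by (simp add: \<omega>_def power_mult_distrib power_mult mult.commute)
        also have "\<dots> \<le> real n ^ card (\<Union>J) * p n ^ card J"
          using sparse[OF J(1)] elim pn by (intro mult_right_mono power_increasing) auto
        finally show "\<omega> n \<le> real n ^ card (\<Union>J) * p n ^ card J" .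
      qed (use F pn pn0 elim \<kappa> many in \<open>auto simp: homs_def\<close>)
      also have "\<dots> \<le> gnp_prob n (p n) (\<lambda>S. cycle_ramsey k l (G n \<union> S))"
      proof (rule gnp_prob_mono[OF pn])
        fix S assume "\<exists>x\<in>?I. (`) x ` ?F \<subseteq> S"
        then obtain x where x: "x \<in> homs {..<n} (G n) ?part ?V" "inj_on x ?V" "(`) x ` ?F \<subseteq> S" by blast
        have "{x (c, j), x (e, j)} \<in> S" if "(c, e) \<in> L" "j < M" for c e j
        proof -
          have "{(c, j), (e, j)} \<in> ?F" using that by (auto simp: link_edges_def)
          then have "x ` {(c, j), (e, j)} \<in> S" using x(3) by blast
          then show ?thesis by simp
        qed
        then have "blowup q part L M x (G n \<union> S)" using x by (auto simp: blowup_def homs_def)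
        then show "cycle_ramsey k l (G n \<union> S)" by (rule M)
      qed
      finally show ?case by (simp add: K_def)
    qed
  qed
qed

section \<open>Vertices covered by the links\<close>

text \<open>Each edge is charged to the source of its link. As \<open>L\<close> is single-valued,
  source and copy index determine the edge.\<close>

lemma card_link_edges_single_valued:
  assumes "single_valued L" and J: "J \<subseteq> link_edges L M" and "finite L"
  shows "card J \<le> card (\<Union>J)"
proof -
  have "\<forall>e\<in>J. \<exists>v. \<exists>d. e = {v, (d, snd v)} \<and> (fst v, d) \<in> L"
  proof
    fix e assume "e \<in> J"
    then obtain c d j where "(c, d) \<in> L" "e = {(c, j), (d, j)}" using J by (auto simp: link_edges_def)
    then show "\<exists>v d. e = {v, (d, snd v)} \<and> (fst v, d) \<in> L"
      by (intro exI[of _ "(c, j)"] exI[of _ d]) simp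
  qed
  then obtain v where "\<forall>e\<in>J. \<exists>d. e = {v e, (d, snd (v e))} \<and> (fst (v e), d) \<in> L"
    unfolding bchoice_iff ..
  then obtain d where v: "\<forall>e\<in>J. e = {v e, (d e, snd (v e))} \<and> (fst (v e), d e) \<in> L"
    unfolding bchoice_iff ..
  have "inj_on v J"
  proof (rule inj_onI)
    fix e e' assume e: "e \<in> J" "e' \<in> J" "v e = v e'"
    then have "(fst (v e), d e) \<in> L" "(fst (v e), d e') \<in> L" using v by auto
    then have "d e = d e'" using assms(1) by (rule single_valuedD[rotated])
    moreover have "e = {v e, (d e, snd (v e))}" using v e(1) by blast
    moreover have "e' = {v e', (d e', snd (v e'))}" using v e(2) by blast
    ultimately show "e = e'" unfolding e(3) by (simp only:)
  qed
  moreover have "v ` J \<subseteq> \<Union>J" using v by blast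
  moreover have "finite (\<Union>J)"
  proof (rule finite_subset)
    show "\<Union>J \<subseteq> (fst ` L \<union> snd ` L) \<times> {..<M}" using J by (force simp: link_edges_def)
  qed (use assms in auto)
  ultimately show ?thesis by (rule card_inj_on_le)
qed

lemma two_cycles_single_valued: "single_valued (two_cycles l k)"
  by (auto simp: single_valued_def two_cycles_def)

lemma two_cycles_bounds:
  assumes "2 \<le> k" "2 \<le> l" "(c, e) \<in> two_cycles l k"
  shows "c < l + k \<and> e < l + k \<and> c \<noteq> e"
proof -
  have "(c + 1) mod l < l + k" "(c + 1) mod k < k" for c using assms by (auto simp: trans_less_add1)
  moreover have "c \<noteq> (c + 1) mod m" if "c < m" "2 \<le> m" for c m :: nat
    using that by (auto simp: mod_Suc)
  ultimately show ?thesis using assms by (auto simp: two_cycles_def simp del: Suc_eq_plus1)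
qed

definition matching_links :: "(nat \<times> nat) set" where
  "matching_links = {(0, 1), (2, 3), (4, 5)}"

text \<open>The edges of \<open>J\<close> are pairwise disjoint, so they cover exactly twice as many
  vertices.\<close>

lemma card_link_edges_matching:
  assumes J: "J \<subseteq> link_edges matching_links M"
  shows "2 * card J \<le> card (\<Union>J)"
proof -
  have e: "\<exists>c j. even c \<and> e = {(c, j), (Suc c, j)}" if eJ: "e \<in> J" for e
  proof -
    obtain c d j where "(c, d) \<in> matching_links" "e = {(c, j), (d, j)}"
      using eJ J by (auto simp: link_edges_def)
    moreover from this have "even c \<and> d = Suc c" by (auto simp: matching_links_def)
    ultimately show ?thesis by blast
  qed
  have "pairwise disjnt J"
    unfolding pairwise_def disjnt_def
  proof (intro ballI impI)
    fix a b assume ab: "a \<in> J" "b \<in> J" "a \<noteq> b"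
    obtain c j where a: "even c" "a = {(c, j), (Suc c, j)}" using e[OF ab(1)] by blast
    obtain c' j' where b: "even c'" "b = {(c', j'), (Suc c', j')}" using e[OF ab(2)] by blast
    show "a \<inter> b = {}" using a b ab(3) by auto
  qed
  moreover have c2: "finite e \<and> card e = 2" if "e \<in> J" for e using e[OF that] by auto
  ultimately have "card (\<Union>J) = (\<Sum>e\<in>J. card e)" by (intro card_Union_disjoint) auto
  also have "\<dots> = (\<Sum>e\<in>J. 2)" using c2 by (intro sum.cong) auto
  finally show ?thesis by simp
qed

section \<open>Assembling the thresholds\<close>

text \<open>Two parts are available at every positive density, and cycles of links cover at least as
  many vertices as edges, whence the exponent 1. The bipartite Turan graph is dense enough for the
  other direction up to \<open>d = 1 / 2\<close>.\<close>

lemma perturbed_threshold_inverse: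
  assumes "odd k" "3 \<le> k" "3 \<le> l" "even l \<or> 5 \<le> l \<or> k = 3 \<and> l = 3" "0 < d" "d \<le> 1 / 2"
  shows "perturbed_threshold k l d (\<lambda>n. 1 / real n)"
  unfolding perturbed_threshold_def
proof (intro conjI allI impI; elim conjE)
  fix p G assume p: "prob_seq p" "filterlim (\<lambda>n. p n / (1 / real n)) at_top sequentially" and G: "dense_seq d G"
  have forces: "forces (l + k) (two_parts l) (two_cycles l k) k l"
    using forces_odd_even_links forces_odd_odd_links forces_3_3_links assms by blast
  have "finite (two_cycles l k)" by (simp add: two_cycles_def)
  then have sparse: "1 * card J \<le> card (\<Union>J)" if "J \<subseteq> link_edges (two_cycles l k) M" for M J
    using card_link_edges_single_valued[OF two_cycles_single_valued that] by simp
  have links: "c < l + k \<and> e < l + k \<and> c \<noteq> e" if "(c, e) \<in> two_cycles l k" for c e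
    using two_cycles_bounds[OF _ _ that] assms by simp
  show "(\<lambda>n. gnp_prob n (p n) (\<lambda>S. cycle_ramsey k l (G n \<union> S))) \<longlonglongrightarrow> 1"
    by (rule upper_threshold_of_forces[OF forces _ _ _ links sparse p(1) _ G, of 1])
      (use p(2) assms in \<open>auto simp: two_parts_def\<close>)
next
  fix p assume "prob_seq p" "(\<lambda>n. p n / (1 / real n)) \<longlonglongrightarrow> 0"
  then show "\<exists>G. dense_seq d G \<and> (\<lambda>n. gnp_prob n (p n) (\<lambda>S. \<not> cycle_ramsey k l (G n \<union> S))) \<longlonglongrightarrow> 1"
    using dense_seq_turan[of 2 d] lower_threshold_bipartite assms by (intro exI[of _ "turan_graph 2"]) auto
qed

text \<open>Density above 1/2 provides three parts, each carrying two classes, and matchings have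
  exponent 2. The upper end of the range of densities enters through \<open>G0\<close>, a dense
  sequence that is not Ramsey by itself.\<close>

lemma perturbed_threshold_inverse_square:
  assumes "odd k" "odd l" "3 \<le> k" "3 \<le> l" "1 / 2 < d"
    and G0: "dense_seq d G0" "\<And>n. \<not> cycle_ramsey k l (G0 n)"
  shows "perturbed_threshold k l d (\<lambda>n. 1 / (real n)^2)"
  unfolding perturbed_threshold_def
proof (intro conjI allI impI; elim conjE)
  fix p G assume p: "prob_seq p" "filterlim (\<lambda>n. p n / (1 / real n ^ 2)) at_top sequentially" and G: "dense_seq d G"
  have forces: "forces 6 (\<lambda>c. c div 2) matching_links k l"
  proof (rule forces_K6[OF assms(1-4)])
    fix c d :: nat assume cd: "c < d" "d < 6"
    show "c div 2 \<noteq> d div 2 \<or> even c \<and> d = c + 1 \<and> (c, d) \<in> matching_links"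
    proof (cases "c div 2 = d div 2")
      case True
      then have "even c" "d = c + 1" using cd by presburger+
      moreover from this have "c = 0 \<or> c = 2 \<or> c = 4" using cd by presburger
      ultimately show ?thesis by (auto simp: matching_links_def)
    qed simp
  qed
  show "(\<lambda>n. gnp_prob n (p n) (\<lambda>S. cycle_ramsey k l (G n \<union> S))) \<longlonglongrightarrow> 1"
    by (rule upper_threshold_of_forces[OF forces _ _ _ _ card_link_edges_matching p(1) p(2) G, of 2])
      (use assms in \<open>auto simp: matching_links_def\<close>)
next
  fix p assume p: "prob_seq p" "(\<lambda>n. p n / (1 / real n ^ 2)) \<longlonglongrightarrow> 0"
  then show "\<exists>G. dense_seq d G \<and> (\<lambda>n. gnp_prob n (p n) (\<lambda>S. \<not> cycle_ramsey k l (G n \<union> S))) \<longlonglongrightarrow> 1"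
    using lower_threshold_empty[where G = G0, OF p G0(2)] G0(1) by blast
qed

theorem theorem1p9:
  fixes k l :: nat
  assumes "k \<ge> 3" and "l \<ge> 3"
    and "(odd k \<and> even l) \<or> ((even k \<longleftrightarrow> even l) \<and> k \<le> l)"
  shows "\<exists>d1 d2 :: real. 0 \<le> d1 \<and> d1 \<le> 1 \<and> 0 \<le> d2 \<and> d2 \<le> 1 \<and>
    (\<forall>d. 0 < d \<and> d < 1 \<longrightarrow>
       (d \<le> d1 \<longrightarrow> perturbed_threshold k l d (\<lambda>n. 1 / real n)) \<and>
       (d1 < d \<and> d \<le> d2 \<longrightarrow> perturbed_threshold k l d (\<lambda>n. 1 / (real n)^2)) \<and>
       (d2 < d \<longrightarrow> threshold_zero k l d)) \<and>
    (even k \<and> even l \<longrightarrow> d1 = 0 \<and> d2 = 0) \<and>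
    (odd k \<and> even l \<longrightarrow> d1 = 1/2 \<and> d2 = 1/2) \<and>
    (odd k \<and> l = 3 \<longrightarrow> d1 = 1/2 \<and> d2 = 4/5) \<and>
    (odd k \<and> odd l \<and> l \<ge> 5 \<longrightarrow> d1 = 1/2 \<and> d2 = 3/4)"
proof -
  \<comment> \<open>If \<open>l = 3\<close>, the parity hypothesis leaves only
    \<open>k \<le> l\<close>, so \<open>k = 3\<close>.\<close>
  consider (even) "even k" "even l" | (odd_even) "odd k" "even l" | (three) "k = 3" "l = 3"
    | (odd) "odd k" "odd l" "5 \<le> l"
  proof -
    have "even l \<or> l = 3 \<or> 5 \<le> l" using assms(2) by presburger
    then show thesis using that assms by (cases "even l"; cases "l = 3") auto
  qed
  then show ?thesis
  proof cases
    case even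
    have "threshold_zero k l d" if "0 < d" for d
      by (rule threshold_zero_of_forces[OF forces_even_even[OF even assms(1,2)], of 1]) (use that in auto)
    with even show ?thesis by (intro exI[of _ 0]) auto
  next
    case odd_even
    have "threshold_zero k l d" if "1 / 2 < d" for d
      by (rule threshold_zero_of_forces[OF forces_odd_even[OF odd_even assms(1,2)], of 2]) (use that in auto)
    moreover have "perturbed_threshold k l d (\<lambda>n. 1 / real n)" if "0 < d" "d \<le> 1 / 2" for d
      using that odd_even assms by (intro perturbed_threshold_inverse) auto
    ultimately show ?thesis using odd_even by (intro exI[of _ "1 / 2"]) auto
  next
    case three
    \<comment> \<open>Here \<open>forces_K6\<close> is used with six separate parts and no links,
      that is, for K_6 itself.\<close>
    have "forces 6 id {} k l" by (rule forces_K6) (use three in auto)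
    then have "threshold_zero k l d" if "4 / 5 < d" for d
      by (rule threshold_zero_of_forces[of _ _ _ _ 5]) (use that in auto)
    moreover have "perturbed_threshold k l d (\<lambda>n. 1 / real n)" if "0 < d" "d \<le> 1 / 2" for d
      using that three by (intro perturbed_threshold_inverse) auto
    moreover have "perturbed_threshold k l d (\<lambda>n. 1 / (real n)^2)" if "1 / 2 < d" "d \<le> 4 / 5" for d
      using that three turan_5_not_ramsey
      by (intro perturbed_threshold_inverse_square[of _ _ _ "turan_graph 5"] dense_seq_turan) auto
    ultimately show ?thesis using three by (intro exI[of _ "1 / 2"] exI[of _ "4 / 5"]) auto
  next
    case odd
    have "threshold_zero k l d" if "3 / 4 < d" for d
      by (rule threshold_zero_of_forces[OF forces_K5[OF odd(1,2) assms(1) odd(3)], of 4]) (use that in auto)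
    moreover have "perturbed_threshold k l d (\<lambda>n. 1 / real n)" if "0 < d" "d \<le> 1 / 2" for d
      using that odd assms by (intro perturbed_threshold_inverse) auto
    moreover have "perturbed_threshold k l d (\<lambda>n. 1 / (real n)^2)" if "1 / 2 < d" "d \<le> 3 / 4" for d
      using that odd assms turan_4_not_ramsey
      by (intro perturbed_threshold_inverse_square[of _ _ _ "turan_graph 4"] dense_seq_turan) auto
    ultimately show ?thesis using odd by (intro exI[of _ "1 / 2"] exI[of _ "3 / 4"]) auto
  qed
qed

end
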